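(* Let $\mathcal{J}\subseteq G_{\mathcal{B}}$ be nonempty and $\beta\in\mathbb{C}^{n-m}$ generic. Then every holomorphic solution $f$ of $D_nI_{\mathcal{J}}+\langle A\theta-\beta\rangle$ can be written as $f=\sum_{\rho\in\mathcal{J}}f_\rho$, where each $f_\rho$ is a solution of $D_nI_\rho+\langle A\theta-\beta\rangle$. In particular, the solutions of $D_nI_{\mathcal{B}}+\langle A\theta-\beta\rangle$ are linear combinations of solutions of the systems $D_nI_\rho+\langle A\theta-\beta\rangle$, $\rho\in G_{\mathcal{B}}$.
   Context: $n>m$; $\mathcal{B}\in\mathbb{Z}^{n\times m}$ of rank $m$ with rows summing to zero; $A=(a_{kj})\in\mathbb{Z}^{(n-m)\times n}$ of rank $n-m$, first row all ones, $A\mathcal{B}=0$. $L_{\mathcal{B}}=\mathcal{B}\mathbb{Z}^m$, $L=\ker_\mathbb{Z}A$. $I_{\mathcal{B}}=\langle\partial^{u_+}-\partial^{u_-}:u\in L_{\mathcal{B}}\rangle$ (lattice ideal; $u=u_+-u_-$, $u_\pm\ge0$ disjoint supports). $G_{\mathcal{B}}$ is the group of characters $\rho:L\to\mathbb{C}^*$ trivial on $L_{\mathcal{B}}$; $I_\rho=\langle\partial^{u_+}-\rho(u)\partial^{u_-}:u\in L\rangle$; one has $I_{\mathcal{B}}=\bigcap_{\rho\in G_{\mathcal{B}}}I_\rho$. $I_{\mathcal{J}}=\bigcap_{\rho\in\mathcal{J}}I_\rho$. $\langle A\theta-\beta\rangle$ denotes the left ideal generated by $\sum_ja_{kj}x_j\partial_j-\beta_k$.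 Generic: outside an exceptional measure-zero set. *)

theory Defs
  imports "HOL-Analysis.Analysis"
begin

definition latL :: "int^'n^'k \<Rightarrow> (int^'n) set" where
  "latL A = {u. A *v u = 0}"

definition latB :: "int^'m^'n \<Rightarrow> (int^'n) set" where
  "latB B = range (\<lambda>v. B *v v)"

text \<open>Characters rho : L \<rightarrow> C^* trivial on L_B; made unique by the
  convention rho u = 0 for u outside L.\<close>
definition charG :: "int^'n^'k \<Rightarrow> int^'m^'n \<Rightarrow> (int^'n \<Rightarrow> complex) set" where
  "charG A B = {\<rho>. (\<forall>u\<in>latL A. \<rho> u \<noteq> 0)
      \<and> (\<forall>u\<in>latL A. \<forall>v\<in>latL A. \<rho> (u + v) = \<rho> u * \<rho> v)
      \<and> (\<forall>u\<in>latB B. \<rho> u = 1)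
      \<and> (\<forall>u. u \<notin> latL A \<longrightarrow> \<rho> u = 0)}"

text \<open>A polynomial in C[\<partial>_1,...,\<partial>_n] is a coefficient function on exponent
  vectors ('n \<Rightarrow> nat) with finite support.\<close>
type_synonym 'n dpoly = "('n \<Rightarrow> nat) \<Rightarrow> complex"

definition dmonom :: "('n \<Rightarrow> nat) \<Rightarrow> 'n dpoly" where
  "dmonom a = (\<lambda>b. if b = a then 1 else 0)"

definition dshift :: "complex \<Rightarrow> ('n \<Rightarrow> nat) \<Rightarrow> 'n dpoly \<Rightarrow> 'n dpoly" where
  "dshift c a p = (\<lambda>b. if (\<forall>j. a j \<le> b j) then c * p (\<lambda>j. b j - a j) else 0)"

inductive_set dideal :: "'n dpoly set \<Rightarrow> 'n dpoly set" for S where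
  gen: "p \<in> S \<Longrightarrow> p \<in> dideal S"
| zero: "(\<lambda>_. 0) \<in> dideal S"
| add: "p \<in> dideal S \<Longrightarrow> q \<in> dideal S \<Longrightarrow> (\<lambda>b. p b + q b) \<in> dideal S"
| mult: "p \<in> dideal S \<Longrightarrow> dshift c a p \<in> dideal S"

definition pos_part :: "int^'n \<Rightarrow> ('n \<Rightarrow> nat)" where
  "pos_part u = (\<lambda>j. nat (u $ j))"

definition neg_part :: "int^'n \<Rightarrow> ('n \<Rightarrow> nat)" where
  "neg_part u = (\<lambda>j. nat (- (u $ j)))"

definition binom :: "int^'n \<Rightarrow> complex \<Rightarrow> 'n dpoly" where
  "binom u c = (\<lambda>b. dmonom (pos_part u) b - c * dmonom (neg_part u) b)"

definition I_rho :: "int^'n^'k \<Rightarrow> (int^'n \<Rightarrow> complex) \<Rightarrow> 'n dpoly set" where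
  "I_rho A \<rho> = dideal {binom u (\<rho> u) | u. u \<in> latL A}"

definition I_J :: "int^'n^'k \<Rightarrow> (int^'n \<Rightarrow> complex) set \<Rightarrow> 'n dpoly set" where
  "I_J A J = (\<Inter>\<rho>\<in>J. I_rho A \<rho>)"

definition I_B :: "int^'m^'n \<Rightarrow> 'n dpoly set" where
  "I_B B = dideal {binom u 1 | u. u \<in> latB B}"

definition holo_on :: "(complex^'n) set \<Rightarrow> (complex^'n \<Rightarrow> complex) \<Rightarrow> bool" where
  "holo_on U f \<longleftrightarrow> (\<forall>z\<in>U. \<exists>D. (f has_derivative D) (at z)
       \<and> (\<forall>c v. D (c *s v) = c * D v))"

definition coord_upd :: "complex^'n \<Rightarrow> 'n \<Rightarrow> complex \<Rightarrow> complex^'n" where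
  "coord_upd z j w = (\<chi> i. if i = j then w else z $ i)"

definition pd :: "'n \<Rightarrow> (complex^'n \<Rightarrow> complex) \<Rightarrow> complex^'n \<Rightarrow> complex" where
  "pd j f z = deriv (\<lambda>w. f (coord_upd z j w)) (z $ j)"

text \<open>\<partial>^a f (coordinates taken in increasing order; for holomorphic f the
  order is irrelevant).\<close>
definition pds where
  "pds a f = foldr (\<lambda>j g. (pd j ^^ a j) g) (sorted_list_of_set UNIV) f"

definition dapply where
  "dapply p f z = (\<Sum>a\<in>{a. p a \<noteq> 0}. p a * pds a f z)"

text \<open>f is a holomorphic solution on the open set U of the left D_n-ideal
  D_n P + < A\<theta> - \<beta> > (P an ideal of C[\<partial>]).\<close>
definition is_solution where
  "is_solution A \<beta> P U f \<longleftrightarrow> holo_on U f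
     \<and> (\<forall>p\<in>P. \<forall>z\<in>U. dapply p f z = 0)
     \<and> (\<forall>k. \<forall>z\<in>U. (\<Sum>j\<in>UNIV. of_int (A $ k $ j) * z $ j * pd j f z) = \<beta> $ k * f z)"

definition real_mat :: "int^'c^'r \<Rightarrow> real^'c^'r" where
  "real_mat M = (\<chi> i j. real_of_int (M $ i $ j))"

end

theory Submission
  imports Defs "HOL-Complex_Analysis.Cauchy_Integral_Formula"
    "HOL-Library.Function_Algebras" "HOL-Library.Poly_Mapping"
begin

text \<open>
  Write \<open>a\<^sub>j\<close> for the columns of \<open>A\<close>. Splitting a solution \<open>f\<close> amounts to extending families of
  functions indexed by \<open>w \<in> \<int>\<^sup>n\<close>, where the member at \<open>w\<close> plays the role of \<open>\<partial>\<^sup>w f\<^sub>\<rho>\<close>.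
  Products of binomials \<open>(\<partial>\<^sup>u\<^sup>+ - \<rho>'(u) \<partial>\<^sup>u\<^sup>-) / (\<rho>(u) - \<rho>'(u))\<close> give operators \<open>P\<^sub>\<rho>\<close> that lie in
  \<open>I\<^sub>\<rho>'\<close> for \<open>\<rho>' \<noteq> \<rho>\<close> and are congruent to one common monomial \<open>\<partial>\<^sup>\<alpha>\<close> modulo \<open>I\<^sub>\<rho>\<close>. Hence
  \<open>P\<^sub>\<rho> f\<close> and its derivatives provide such families for \<open>w \<in> \<alpha> + \<nat>\<^sup>n + L\<close>.

  If the columns \<open>a\<^sub>j\<close> with \<open>j \<in> \<sigma>\<close> do not span, choose \<open>l \<noteq> 0\<close> orthogonal to them. The Euler
  equations force \<open>l\<cdot>(\<beta> - A w) \<Phi>(w) = \<Sum>\<^sub>j (l\<cdot>a\<^sub>j) x\<^sub>j \<Phi>(w + e\<^sub>j)\<close>, a sum over \<open>j \<notin> \<sigma>\<close> only. For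
  generic \<open>\<beta>\<close> the factor on the left never vanishes, so this equation extends the family to all \<open>w\<close>
  with \<open>w + e\<^sub>j\<close> in the old index set for every \<open>j \<notin> \<sigma>\<close>, and the extension satisfies the same
  relations. If the columns with \<open>w\<^sub>j\<close> large do span, then \<open>w \<in> \<alpha> + \<nat>\<^sup>n + L\<close> by rounding real
  solutions of linear equations. So finitely many extensions reach \<open>w = 0\<close>, and \<open>f\<^sub>\<rho> = \<Phi>\<^sub>\<rho>(0)\<close>.
  For \<open>I\<^sub>\<B>\<close> it suffices that its solutions are killed by \<open>\<Inter>\<^sub>\<rho> I\<^sub>\<rho>\<close>, by orthogonality of characters.
\<close>

section \<open>Holomorphic functions of several variables\<close>

lemma norm_axis_complex [simp]: "norm (axis j c :: complex^'n::finite) = norm c"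
  by (simp add: norm_vec_def axis_def L2_set_def if_distrib[of norm] if_distrib[of "\<lambda>x. x\<^sup>2"] cong: if_cong)

lemma bounded_linear_axis: "bounded_linear (axis j :: complex \<Rightarrow> complex^'n::finite)"
  by (intro linear_conv_bounded_linear[THEN iffD1] linearI) (auto simp: axis_def vec_eq_iff)

lemma coord_upd_eq: "coord_upd z j w = z + axis j (w - z $ j)"
  by (simp add: coord_upd_def vec_eq_iff axis_def)

text \<open>By the chain rule the derivative along the j-th axis is c |-> D (axis j c), and complex
  homogeneity of D turns this into multiplication by \<open>D (axis j 1)\<close>, that is, a complex
  derivative.\<close>

lemma holo_on_slice:
  fixes f :: "complex^'n::finite \<Rightarrow> complex"
  assumes D: "(f has_derivative D) (at (z + axis j w))" and Dc: "\<And>c v. D (c *s v) = c * D v"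
  shows "((\<lambda>w. f (z + axis j w)) has_field_derivative D (axis j 1)) (at w)"
proof -
  have g: "((\<lambda>w. z + axis j w) has_derivative axis j) (at w)"
    using has_derivative_add[OF has_derivative_const bounded_linear_imp_has_derivative[OF bounded_linear_axis[of j], of "at w"]] by simp
  have "((\<lambda>w. f (z + axis j w)) has_derivative (\<lambda>c. D (axis j c))) (at w)"
    using has_derivative_compose[OF g, of f D] D by simp
  moreover have "(\<lambda>c. D (axis j c)) = (*) (D (axis j 1))"
  proof
    fix c
    have "axis j c = c *s (axis j 1 :: complex^'n)" by (simp add: axis_def vec_eq_iff)
    then show "D (axis j c) = D (axis j 1) * c" by (simp only: Dc mult.commute)
  qed
  ultimately show ?thesis
    by (simp only: has_field_derivative_def)
qed

text \<open>A complex linear D is determined by its values on the standard basis, and the slices in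
  the coordinate directions identify these values with the partial derivatives.\<close>

lemma holo_on_has_derivative:
  fixes f :: "complex^'n::finite \<Rightarrow> complex"
  assumes "holo_on U f" "z \<in> U"
  shows "(f has_derivative (\<lambda>v. \<Sum>j\<in>UNIV. v $ j * pd j f z)) (at z)"
proof -
  obtain D where D: "(f has_derivative D) (at z)" and Dc: "\<And>c v. D (c *s v) = c * D v"
    using assms unfolding holo_on_def by blast
  have pd: "pd j f z = D (axis j 1)" for j
  proof -
    have "((\<lambda>w. f (z + axis j w)) has_field_derivative D (axis j 1)) (at 0)"
      by (rule holo_on_slice) (use D Dc in \<open>auto simp: axis_def zero_vec_def[symmetric] cong: if_cong\<close>)
    then have "((\<lambda>w. f (z + axis j (w - z $ j))) has_field_derivative D (axis j 1)) (at (z $ j))"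
      using DERIV_shift[of "\<lambda>w. f (z + axis j w)" _ "z $ j" "- z $ j"] by (simp add: algebra_simps)
    then show ?thesis
      by (simp add: pd_def coord_upd_eq DERIV_imp_deriv)
  qed
  interpret linear D using D has_derivative_linear by blast
  have "D v = (\<Sum>j\<in>UNIV. v $ j * pd j f z)" for v
  proof -
    have "D v = D (\<Sum>j\<in>UNIV. v $ j *s axis j 1)" by (simp only: basis_expansion)
    also have "\<dots> = (\<Sum>j\<in>UNIV. v $ j * pd j f z)" by (simp add: sum Dc pd)
    finally show ?thesis .
  qed
  then have "D = (\<lambda>v. \<Sum>j\<in>UNIV. v $ j * pd j f z)" by blast
  then show ?thesis using D by simp
qed

lemma holo_onI:
  fixes f :: "complex^'n::finite \<Rightarrow> complex"
  assumes "\<And>z. z \<in> U \<Longrightarrow> (f has_derivative (\<lambda>v. \<Sum>j\<in>UNIV. v $ j * d z j)) (at z)"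
  shows "holo_on U f"
  unfolding holo_on_def
proof
  fix z assume "z \<in> U"
  then show "\<exists>D. (f has_derivative D) (at z) \<and> (\<forall>c v. D (c *s v) = c * D v)"
    by (intro exI[of _ "\<lambda>v. \<Sum>j\<in>UNIV. v $ j * d z j"] conjI assms)
      (simp_all add: sum_distrib_left mult.assoc)
qed

lemma pd_slice:
  fixes f :: "complex^'n::finite \<Rightarrow> complex"
  assumes "holo_on U f" "z + axis j w \<in> U"
  shows "((\<lambda>w. f (z + axis j w)) has_field_derivative pd j f (z + axis j w)) (at w)"
proof -
  have "((\<lambda>w. f (z + axis j w)) has_field_derivative
      (\<Sum>i\<in>UNIV. axis j 1 $ i * pd i f (z + axis j w))) (at w)"
    by (rule holo_on_slice[OF holo_on_has_derivative[OF assms]])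
      (simp add: sum_distrib_left mult.assoc)
  moreover have "(\<Sum>i\<in>UNIV. axis j 1 $ i * pd i f (z + axis j w)) = pd j f (z + axis j w)"
    by (simp add: axis_def if_distrib[of "\<lambda>x. x * _"] cong: if_cong)
  ultimately show ?thesis by simp
qed

lemma pd_eqI:
  fixes f :: "complex^'n::finite \<Rightarrow> complex"
  assumes "(f has_derivative (\<lambda>v. \<Sum>j\<in>UNIV. v $ j * d j)) (at z)"
  shows "pd j f z = d j"
proof -
  \<comment> \<open>\<open>holo_on\<close> asks for a derivative at each point of the set and not
    for openness, so a single point is admissible.\<close>
  have "holo_on {z} f"
    using assms by (intro holo_onI[where d="\<lambda>_. d"]) auto
  then have "(f has_derivative (\<lambda>v. \<Sum>j\<in>UNIV. v $ j * pd j f z)) (at z)"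
    by (rule holo_on_has_derivative) simp
  then have "(\<lambda>v. \<Sum>j\<in>UNIV. v $ j * pd j f z) = (\<lambda>v. \<Sum>j\<in>UNIV. v $ j * d j)"
    by (rule has_derivative_unique) (fact assms)
  then have "(\<Sum>i\<in>UNIV. axis j 1 $ i * pd i f z) = (\<Sum>i\<in>UNIV. axis j 1 $ i * d i)"
    by meson
  then show ?thesis
    by (simp add: axis_def if_distrib[of "\<lambda>x. x * _"] cong: if_cong)
qed

section \<open>Cauchy integrals for partial derivatives\<close>

lemma deriv_0_circle_integral:
  assumes S: "open S" "cball 0 r \<subseteq> S" "F holomorphic_on S" "r > 0"
  shows "deriv F 0 = integral {0..2*pi} (\<lambda>t. F (r * cis t) * (cis (-t) / (2 * pi * r)))"
proof -
  have "contour_integral (circlepath 0 r) (\<lambda>u. F u / (u - 0)^2) = (2 * pi * \<i>) * deriv F 0"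
    by (rule Cauchy_contour_integral_circlepath_2)
      (use S in \<open>auto intro!: holomorphic_on_imp_continuous_on intro!: holomorphic_on_subset[OF S(3)]\<close>)
  moreover have "contour_integral (circlepath 0 r) (\<lambda>u. F u / (u - 0)^2)
      = integral {0..2*pi} (\<lambda>t. F (0 + r * cis t) / (0 + r * cis t - 0)^2 * r * \<i> * cis t)"
    unfolding circlepath_def by (rule contour_integral_part_circlepath_eq) simp
  \<comment> \<open>One factor \<open>r * cis t\<close> of the squared denominator cancels against
    the velocity of the circle; the reciprocal of the other is \<open>cis (-t) / r\<close>.\<close>
  moreover have "F (0 + r * cis t) / (0 + r * cis t - 0)^2 * r * \<i> * cis t
      = (2 * pi * \<i>) * (F (r * cis t) * (cis (-t) / (2 * pi * r)))" for t
    using S(4) by (simp add: power2_eq_square field_simps cis_mult flip: cis_inverse)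
  ultimately have "(2 * pi * \<i>) * deriv F 0
     = (2 * pi * \<i>) * integral {0..2*pi} (\<lambda>t. F (r * cis t) * (cis (-t) / (2 * pi * r)))"
    by simp
  moreover have "2 * pi * \<i> \<noteq> 0" by simp
  ultimately show ?thesis
    using mult_left_cancel by blast
qed

text \<open>Expresses a partial derivative through values of f alone, so that regularity of
  \<open>pd j f\<close> can be read off from an integral with parameter z.\<close>

lemma pd_circle_integral:
  fixes f :: "complex^'n::finite \<Rightarrow> complex"
  assumes f: "holo_on U f" and U: "open U" and r: "r > 0" and sub: "cball z r \<subseteq> U"
  shows "pd j f z = integral (cbox 0 (2*pi)) (\<lambda>t. f (z + axis j (r * cis t)) * (cis (-t) / (2 * pi * r)))"
proof -
  define S where "S = {w. z + axis j w \<in> U}"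
  have "open S"
    unfolding S_def using U
    by (intro open_vimage[of U "\<lambda>w. z + axis j w", unfolded vimage_def] continuous_intros
        linear_continuous_on bounded_linear_axis)
  moreover have "cball 0 r \<subseteq> S"
    using sub by (auto simp: S_def subset_iff dist_norm)
  moreover have "(\<lambda>w. f (z + axis j w)) holomorphic_on S"
    unfolding holomorphic_on_def
  proof
    fix w assume "w \<in> S"
    then have "z + axis j w \<in> U" by (simp add: S_def)
    from pd_slice[OF f this] show "(\<lambda>w. f (z + axis j w)) field_differentiable at w within S"
      unfolding field_differentiable_def by (blast intro: has_field_derivative_at_within)
  qed
  ultimately have "deriv (\<lambda>w. f (z + axis j w)) 0
      = integral {0..2*pi} (\<lambda>t. f (z + axis j (r * cis t)) * (cis (-t) / (2 * pi * r)))"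
    using r by (rule deriv_0_circle_integral)
  moreover have "deriv (\<lambda>w. f (z + axis j w)) 0 = pd j f z"
  proof -
    have z0: "z + axis j 0 = z" by (simp add: axis_def vec_eq_iff)
    have "z + axis j 0 \<in> U" using sub r by (auto simp: z0)
    from DERIV_imp_deriv[OF pd_slice[OF f this]] show ?thesis by (simp add: z0)
  qed
  ultimately show ?thesis by simp
qed

text \<open>While x runs through the ball of radius r, the circle of radius r around x stays in the
  ball of radius 2r; hence the doubled radius in the hypothesis.\<close>

lemma continuous_on_circle_integrand:
  fixes f :: "complex^'n::finite \<Rightarrow> 'b::real_normed_vector"
  assumes f: "continuous_on U f" and sub: "ball z0 (2*r) \<subseteq> U" and r: "r > 0"
  shows "continuous_on (ball z0 r \<times> T) (\<lambda>(x, t). f (x + axis j (r * cis t)))"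
proof -
  have "x + axis j (r * cis t) \<in> U" if "x \<in> ball z0 r" for x t
  proof -
    have "dist z0 (x + axis j (r * cis t)) \<le> dist z0 x + norm (axis j (r * cis t) :: complex^'n)"
      by (metis add_diff_cancel_left' dist_norm dist_triangle norm_minus_commute)
    also have "\<dots> < r + r" using that r by (simp add: norm_mult)
    finally show ?thesis using sub by (auto simp: subset_iff)
  qed
  moreover have "continuous_on (ball z0 r \<times> T) (\<lambda>p. axis j (r * cis (snd p)) :: complex^'n)"
    by (rule continuous_on_compose2[OF linear_continuous_on[OF bounded_linear_axis, of UNIV]]) (intro continuous_intros, simp)
  ultimately show ?thesis
    unfolding case_prod_unfold
    by (intro continuous_on_compose2[OF f] continuous_on_add continuous_on_fst continuous_on_id) auto
qed

lemma cball_subset_double_ball: "z \<in> ball z0 r \<Longrightarrow> cball z r \<subseteq> ball z0 (2 * r)"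
  for z0 :: "'a::metric_space"
proof
  fix x assume "z \<in> ball z0 r" "x \<in> cball z r"
  then show "x \<in> ball z0 (2 * r)" using dist_triangle[of z0 x z] by simp
qed

lemma open_double_ball:
  assumes "open U" "z \<in> U"
  obtains r where "r > 0" "ball z (2 * r) \<subseteq> U"
proof -
  obtain e where "e > 0" "ball z e \<subseteq> U" using assms openE by blast
  then show ?thesis by (intro that[of "e/2"]) auto
qed

section \<open>Holomorphy and symmetry of partial derivatives\<close>

lemma holo_on_imp_continuous_on:
  fixes f :: "complex^'n::finite \<Rightarrow> complex"
  assumes f: "holo_on U f"
  shows "continuous_on U f"
proof (rule continuous_at_imp_continuous_on, rule ballI)
  fix z assume "z \<in> U"
  from has_derivative_continuous[OF holo_on_has_derivative[OF f this]]
  show "isCont f z" .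
qed

lemma continuous_on_pd:
  fixes f :: "complex^'n::finite \<Rightarrow> complex"
  assumes f: "holo_on U f" and U: "open U"
  shows "continuous_on U (pd j f)"
proof (intro continuous_at_imp_continuous_on ballI)
  fix z0 assume "z0 \<in> U"
  then obtain r where r: "r > 0" "ball z0 (2 * r) \<subseteq> U" using open_double_ball[OF U] by blast
  have "continuous_on (ball z0 r \<times> cbox 0 (2*pi))
      (\<lambda>(x, t). f (x + axis j (r * cis t)) * (cis (-t) / (2 * pi * r)))"
    using continuous_on_circle_integrand[OF holo_on_imp_continuous_on[OF f] r(2,1), of "cbox 0 (2*pi)" j]
    unfolding case_prod_unfold using r(1) by (intro continuous_intros) auto
  from integral_continuous_on_param[OF this]
  have *: "continuous_on (ball z0 r) (\<lambda>x. integral (cbox 0 (2*pi))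
      (\<lambda>t. f (x + axis j (r * cis t)) * (cis (-t) / (2 * pi * r))))" .
  have "continuous_on (ball z0 r) (pd j f)"
  proof (rule continuous_on_eq[OF *])
    fix x assume "x \<in> ball z0 r"
    then have "cball x r \<subseteq> U" using cball_subset_double_ball r(2) by blast
    from pd_circle_integral[OF f U r(1) this, symmetric]
    show "integral (cbox 0 (2*pi)) (\<lambda>t. f (x + axis j (r * cis t)) * (cis (-t) / (2 * pi * r))) = pd j f x" .
  qed
  then show "isCont (pd j f) z0"
    using r(1) by (simp add: continuous_on_eq_continuous_at)
qed

text \<open>Differentiation under the integral sign uses derivatives with values in the bounded
  linear maps, so the row of partial derivatives is packaged as such a map.\<close>

definition lin_form :: "complex^'n::finite \<Rightarrow> ((complex^'n) \<Rightarrow>\<^sub>L complex)" where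
  "lin_form c = Blinfun (\<lambda>v. \<Sum>i\<in>UNIV. v $ i * c $ i)"

lemma lin_form_apply [simp]: "blinfun_apply (lin_form c) v = (\<Sum>i\<in>UNIV. v $ i * c $ i)"
proof -
  have "bounded_linear (\<lambda>v. \<Sum>i\<in>UNIV. v $ i * c $ i)"
    by (intro linear_conv_bounded_linear[THEN iffD1] linearI)
      (simp_all add: algebra_simps sum.distrib scaleR_sum_right)
  then show ?thesis by (simp add: lin_form_def bounded_linear_Blinfun_apply)
qed

lemma bounded_linear_lin_form: "bounded_linear lin_form"
  by (intro linear_conv_bounded_linear[THEN iffD1] linearI blinfun_eqI)
    (simp_all add: algebra_simps sum.distrib scaleR_sum_right blinfun.add_left blinfun.scaleR_left)

text \<open>The Cauchy integral for \<open>pd j f\<close> is differentiated under the integral sign;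
  the coefficients d i are the Cauchy integrals of \<open>pd i f\<close>. They are recognised as
  mixed derivatives once \<open>pd i f\<close> is holomorphic, hence the conditional clause: the
  first clause yields that holomorphy, and then the second yields symmetry.\<close>

lemma has_derivative_pd:
  fixes f :: "complex^'n::finite \<Rightarrow> complex"
  assumes f: "holo_on U f" and U: "open U" and z0: "z0 \<in> U"
  shows "\<exists>d. (pd j f has_derivative (\<lambda>v. \<Sum>i\<in>UNIV. v $ i * d i)) (at z0)
    \<and> (\<forall>i. holo_on U (pd i f) \<longrightarrow> d i = pd j (pd i f) z0)"
proof -
  obtain r where r: "r > 0" "ball z0 (2 * r) \<subseteq> U" using open_double_ball[OF U z0] by blast
  define k where "k t = cis (-t) / (2 * pi * r)" for t
  define F where "F x t = f (x + axis j (r * cis t)) * k t" for x t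
  define G :: "complex^'n \<Rightarrow> real \<Rightarrow> ((complex^'n) \<Rightarrow>\<^sub>L complex)" where
    "G x t = lin_form (\<chi> i. pd i f (x + axis j (r * cis t)) * k t)" for x t
  have inU: "x + axis j (r * cis t) \<in> U" if "x \<in> ball z0 r" for x t
  proof -
    have "x + axis j (r * cis t) \<in> cball x r" using r(1) by (simp add: dist_norm norm_mult)
    then show ?thesis using cball_subset_double_ball[OF that] r(2) by blast
  qed
  have k: "continuous_on T k" for T
    unfolding k_def using r(1) by (intro continuous_intros) auto
  have ks: "continuous_on T (\<lambda>p. k (snd p))" for T :: "((complex^'n) \<times> real) set"
    by (rule continuous_on_compose2[OF k[of UNIV] continuous_on_snd[OF continuous_on_id]]) simp
  have cF: "continuous_on (ball z0 r \<times> cbox 0 (2*pi)) (\<lambda>(x, t). F x t)"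
    using continuous_on_circle_integrand[OF holo_on_imp_continuous_on[OF f] r(2,1), of "cbox 0 (2*pi)" j]
    unfolding case_prod_unfold F_def
    by (intro continuous_on_mult ks)
  have cG: "continuous_on (ball z0 r \<times> cbox 0 (2*pi)) (\<lambda>(x, t). G x t)"
  proof -
    have "continuous_on (ball z0 r \<times> cbox 0 (2*pi)) (\<lambda>p. pd i f (fst p + axis j (r * cis (snd p))) * k (snd p))" for i
      using continuous_on_circle_integrand[OF continuous_on_pd[OF f U, of i] r(2,1), of "cbox 0 (2*pi)" j]
      unfolding case_prod_unfold
      by (intro continuous_on_mult ks)
    then show ?thesis
      unfolding case_prod_unfold G_def
      by (intro continuous_on_compose2[OF linear_continuous_on[OF bounded_linear_lin_form, of UNIV]]
          continuous_on_vec_lambda) auto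
  qed
  have dF: "((\<lambda>x. F x t) has_derivative blinfun_apply (G x t)) (at x within ball z0 r)"
    if "x \<in> ball z0 r" for x t
  proof -
    have "((\<lambda>x. x + axis j (r * cis t)) has_derivative (\<lambda>v. v)) (at x)"
      by (auto intro!: derivative_eq_intros)
    from has_derivative_compose[OF this holo_on_has_derivative[OF f inU[OF that]]]
    have "((\<lambda>x. F x t) has_derivative
        (\<lambda>v. (\<Sum>i\<in>UNIV. v $ i * pd i f (x + axis j (r * cis t))) * k t)) (at x)"
      unfolding F_def by (rule has_derivative_mult_left)
    moreover have "blinfun_apply (G x t) = (\<lambda>v. (\<Sum>i\<in>UNIV. v $ i * pd i f (x + axis j (r * cis t))) * k t)"
      by (rule ext) (simp add: G_def sum_distrib_right mult.assoc)
    ultimately show ?thesis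
      by (simp add: has_derivative_at_withinI)
  qed
  have eq: "pd j f x = integral (cbox 0 (2*pi)) (F x)" if "x \<in> ball z0 r" for x
    unfolding F_def k_def
    by (rule pd_circle_integral[OF f U r(1)]) (use cball_subset_double_ball[OF that] r(2) in blast)
  have "((\<lambda>x. integral (cbox 0 (2*pi)) (F x)) has_derivative integral (cbox 0 (2*pi)) (G z0))
      (at z0 within ball z0 r)"
  proof (rule leibniz_rule[OF dF _ cG])
    show "F x integrable_on cbox 0 (2*pi)" if "x \<in> ball z0 r" for x
    proof (rule integrable_continuous)
      have "continuous_on (cbox 0 (2*pi)) (\<lambda>t. (\<lambda>(x, t). F x t) (x, t))"
        by (rule continuous_on_compose2[OF cF continuous_on_Pair])
          (use that in \<open>auto intro!: continuous_intros\<close>)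
      then show "continuous_on (cbox 0 (2*pi)) (F x)" by simp
    qed
  qed (use r(1) in auto)
  then have "(pd j f has_derivative integral (cbox 0 (2*pi)) (G z0)) (at z0 within ball z0 r)"
    by (rule has_derivative_transform[rotated 2]) (use r(1) in \<open>simp_all only: eq centre_in_ball\<close>)
  then have *: "(pd j f has_derivative integral (cbox 0 (2*pi)) (G z0)) (at z0)"
    using r(1) by (simp add: at_within_open[of _ "ball z0 r"])
  define d where "d i = integral (cbox 0 (2*pi)) (\<lambda>t. pd i f (z0 + axis j (r * cis t)) * k t)" for i
  have "continuous_on (cbox 0 (2*pi)) (\<lambda>t. (\<lambda>(x, t). G x t) (z0, t))"
    by (rule continuous_on_compose2[OF cG continuous_on_Pair])
      (use r(1) in \<open>auto intro!: continuous_intros\<close>)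
  then have cz: "continuous_on (cbox 0 (2*pi)) (G z0)" by simp
  have ci: "(\<lambda>t. pd i f (z0 + axis j (r * cis t)) * k t) integrable_on cbox 0 (2*pi)" for i
  proof -
    have "(\<lambda>t. blinfun_apply (G z0 t) (axis i 1)) integrable_on cbox 0 (2*pi)"
      by (intro integrable_continuous continuous_intros cz)
    then show ?thesis
      by (simp add: G_def axis_def if_distrib[of "\<lambda>x. x * _"] cong: if_cong)
  qed
  have "blinfun_apply (integral (cbox 0 (2*pi)) (G z0)) v = (\<Sum>i\<in>UNIV. v $ i * d i)" for v
  proof -
    have "blinfun_apply (integral (cbox 0 (2*pi)) (G z0)) v = integral (cbox 0 (2*pi)) (\<lambda>t. blinfun_apply (G z0 t) v)"
      by (intro blinfun_apply_integral integrable_continuous cz)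
    also have "\<dots> = (\<Sum>i\<in>UNIV. integral (cbox 0 (2*pi)) (\<lambda>t. v $ i * (pd i f (z0 + axis j (r * cis t)) * k t)))"
      unfolding G_def lin_form_apply vec_lambda_beta
      by (intro integral_sum integrable_on_mult_right ci) simp
    finally show ?thesis by (simp add: d_def)
  qed
  then have "blinfun_apply (integral (cbox 0 (2*pi)) (G z0)) = (\<lambda>v. \<Sum>i\<in>UNIV. v $ i * d i)" by blast
  moreover have "d i = pd j (pd i f) z0" if "holo_on U (pd i f)" for i
    unfolding d_def k_def
    by (rule pd_circle_integral[OF that U r(1), symmetric])
      (use cball_subset_double_ball[of z0 z0 r] r in auto)
  ultimately show ?thesis using * by (intro exI[of _ d]) simp
qed

lemma holo_on_pd:
  fixes f :: "complex^'n::finite \<Rightarrow> complex"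
  assumes "holo_on U f" and "open U"
  shows "holo_on U (pd j f)"
proof -
  have "\<forall>z\<in>U. \<exists>d. (pd j f has_derivative (\<lambda>v. \<Sum>i\<in>UNIV. v $ i * d i)) (at z)"
    using has_derivative_pd[OF assms] by blast
  then obtain d where "\<forall>z\<in>U. (pd j f has_derivative (\<lambda>v. \<Sum>i\<in>UNIV. v $ i * d z i)) (at z)"
    unfolding bchoice_iff by blast
  then show ?thesis by (intro holo_onI[of U _ d]) blast
qed

lemma pd_commute:
  fixes f :: "complex^'n::finite \<Rightarrow> complex"
  assumes "holo_on U f" and "open U" and "z \<in> U"
  shows "pd i (pd j f) z = pd j (pd i f) z"
proof -
  obtain d where "(pd j f has_derivative (\<lambda>v. \<Sum>i\<in>UNIV. v $ i * d i)) (at z)"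
    and "d i = pd j (pd i f) z"
    using has_derivative_pd[OF assms, of j] holo_on_pd[OF assms(1,2)] by blast
  then show ?thesis using pd_eqI[of "pd j f" d z i] by simp
qed

section \<open>Differential operators on an open set\<close>

text \<open>Functions are cut off to zero outside \<open>U\<close>, so that operator identities on \<open>U\<close> become
  equations between functions.\<close>

definition HU :: "(complex^'n::finite) set \<Rightarrow> (complex^'n \<Rightarrow> complex) set" where
  "HU U = {f. holo_on U f \<and> (\<forall>z. z \<notin> U \<longrightarrow> f z = 0)}"

definition dd :: "(complex^'n::finite) set \<Rightarrow> 'n \<Rightarrow> (complex^'n \<Rightarrow> complex) \<Rightarrow> complex^'n \<Rightarrow> complex" where
  "dd U j f = (\<lambda>z. if z \<in> U then pd j f z else 0)"

lemma has_derivative_cong_open: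
  assumes "open U" "z \<in> U" "\<And>w. w \<in> U \<Longrightarrow> f w = g w"
  shows "(f has_derivative D) (at z) \<longleftrightarrow> (g has_derivative D) (at z)"
  using assms has_derivative_transform_within_open[of f D z UNIV U g]
    has_derivative_transform_within_open[of g D z UNIV U f] by auto

lemma holo_on_cong:
  fixes f :: "complex^'n::finite \<Rightarrow> complex"
  assumes "open U" "\<And>w. w \<in> U \<Longrightarrow> f w = g w"
  shows "holo_on U f \<longleftrightarrow> holo_on U g"
  unfolding holo_on_def using has_derivative_cong_open[OF assms(1) _ assms(2)] by simp

lemma pd_cong_open:
  fixes f :: "complex^'n::finite \<Rightarrow> complex"
  assumes U: "open U" and z: "z \<in> U" and fg: "\<And>w. w \<in> U \<Longrightarrow> f w = g w"
  shows "pd j f z = pd j g z"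
proof -
  define S where "S = {w. coord_upd z j w \<in> U}"
  have "continuous_on UNIV (coord_upd z j)"
    unfolding coord_upd_eq
    by (intro continuous_intros continuous_on_compose2[OF linear_continuous_on[OF bounded_linear_axis, of UNIV]]) auto
  then have "open S"
    unfolding S_def using open_vimage[OF U, of "coord_upd z j"] by (simp add: vimage_def)
  moreover have "coord_upd z j (z $ j) = z" by (simp add: coord_upd_def vec_eq_iff)
  then have "z $ j \<in> S" using z by (simp add: S_def)
  ultimately have "eventually (\<lambda>w. w \<in> S) (nhds (z $ j))"
    by (rule eventually_nhds_in_open)
  then have "eventually (\<lambda>w. f (coord_upd z j w) = g (coord_upd z j w)) (nhds (z $ j))"
    by (rule eventually_mono) (simp add: S_def fg)
  then show ?thesis
    unfolding pd_def by (rule deriv_cong_ev) simp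
qed

section \<open>Calculus of the cut-off derivations\<close>

locale open_dom =
  fixes U :: "(complex, 'n::{finite,linorder}) vec set"
  assumes open_U: "open U"
begin

lemma HU_has_derivative:
  "f \<in> HU U \<Longrightarrow> z \<in> U \<Longrightarrow> (f has_derivative (\<lambda>v. \<Sum>j\<in>UNIV. v $ j * dd U j f z)) (at z)"
  using holo_on_has_derivative[of U f z] by (simp add: HU_def dd_def)

lemma HU_I:
  assumes "\<And>z. z \<in> U \<Longrightarrow> (f has_derivative (\<lambda>v. \<Sum>j\<in>UNIV. v $ j * d z j)) (at z)"
    and "\<And>z. z \<notin> U \<Longrightarrow> f z = 0"
  shows "f \<in> HU U"
  using assms holo_onI[of U f d] by (auto simp: HU_def)

lemma dd_eqI:
  assumes "(f has_derivative (\<lambda>v. \<Sum>j\<in>UNIV. v $ j * d j)) (at z)" "z \<in> U"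
  shows "dd U j f z = d j"
  using assms pd_eqI by (simp add: dd_def)

lemma dd_off: "z \<notin> U \<Longrightarrow> dd U j f z = 0"
  by (simp add: dd_def)

lemma HU_off: "f \<in> HU U \<Longrightarrow> z \<notin> U \<Longrightarrow> f z = 0"
  by (simp add: HU_def)

lemma HU_zero: "(\<lambda>z. 0) \<in> HU U"
  by (rule HU_I[where d="\<lambda>_ _. 0"]) auto

lemma has_derivative_cmult:
  assumes "f \<in> HU U" "z \<in> U"
  shows "((\<lambda>z. c * f z) has_derivative (\<lambda>v. \<Sum>j\<in>UNIV. v $ j * (c * dd U j f z))) (at z)"
  using has_derivative_mult_right[OF HU_has_derivative[OF assms], of c]
  by (simp add: sum_distrib_left mult_ac)

lemma has_derivative_plus:
  assumes "f \<in> HU U" "g \<in> HU U" "z \<in> U"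
  shows "((\<lambda>z. f z + g z) has_derivative (\<lambda>v. \<Sum>j\<in>UNIV. v $ j * (dd U j f z + dd U j g z))) (at z)"
  using has_derivative_add[OF HU_has_derivative[OF assms(1,3)] HU_has_derivative[OF assms(2,3)]]
  by (simp add: sum.distrib distrib_left)

lemma has_derivative_coord:
  assumes "f \<in> HU U" "z \<in> U"
  shows "((\<lambda>z. z $ i * f z) has_derivative
    (\<lambda>v. \<Sum>j\<in>UNIV. v $ j * (z $ i * dd U j f z + (if i = j then f z else 0)))) (at z)"
proof -
  have "((\<lambda>z. z $ i) has_derivative (\<lambda>v. v $ i)) (at z)"
    by (rule bounded_linear_imp_has_derivative) (rule bounded_linear_vec_nth)
  from has_derivative_mult[OF this HU_has_derivative[OF assms]]
  have "((\<lambda>z. z $ i * f z) has_derivative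
    (\<lambda>v. z $ i * (\<Sum>j\<in>UNIV. v $ j * dd U j f z) + v $ i * f z)) (at z)" .
  moreover have "z $ i * (\<Sum>j\<in>UNIV. v $ j * dd U j f z) + v $ i * f z
     = (\<Sum>j\<in>UNIV. v $ j * (z $ i * dd U j f z + (if i = j then f z else 0)))" for v
    by (simp add: distrib_left sum.distrib sum_distrib_left mult_ac
        if_distrib[of "\<lambda>x. x * _"] if_distrib[of "\<lambda>x. _ * x"] cong: if_cong)
  ultimately show ?thesis by simp
qed

lemma HU_cmult: "f \<in> HU U \<Longrightarrow> (\<lambda>z. c * f z) \<in> HU U"
  by (rule HU_I[OF has_derivative_cmult]) (auto simp: HU_off)

lemma HU_add: "f \<in> HU U \<Longrightarrow> g \<in> HU U \<Longrightarrow> (\<lambda>z. f z + g z) \<in> HU U"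
  by (rule HU_I[OF has_derivative_plus]) (auto simp: HU_off)

lemma HU_coord: "f \<in> HU U \<Longrightarrow> (\<lambda>z. z $ i * f z) \<in> HU U"
  by (rule HU_I[OF has_derivative_coord]) (auto simp: HU_off)

lemma HU_dd: "f \<in> HU U \<Longrightarrow> dd U j f \<in> HU U"
  using holo_on_pd[OF _ open_U, of f j] holo_on_cong[OF open_U, of "dd U j f" "pd j f"]
  by (simp add: HU_def dd_def)

lemma HU_sum:
  assumes "\<And>i. i \<in> I \<Longrightarrow> f i \<in> HU U"
  shows "(\<lambda>z. \<Sum>i\<in>I. c i * f i z) \<in> HU U"
  using assms by (induction I rule: infinite_finite_induct) (auto intro!: HU_zero HU_add HU_cmult)

lemma dd_cmult: "f \<in> HU U \<Longrightarrow> dd U j (\<lambda>z. c * f z) = (\<lambda>z. c * dd U j f z)"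
proof
  fix z assume "f \<in> HU U"
  then show "dd U j (\<lambda>z. c * f z) z = c * dd U j f z"
    by (cases "z \<in> U") (simp_all add: dd_eqI[OF has_derivative_cmult] dd_off)
qed

lemma dd_add: "f \<in> HU U \<Longrightarrow> g \<in> HU U \<Longrightarrow> dd U j (\<lambda>z. f z + g z) = (\<lambda>z. dd U j f z + dd U j g z)"
proof
  fix z assume "f \<in> HU U" "g \<in> HU U"
  then show "dd U j (\<lambda>z. f z + g z) z = dd U j f z + dd U j g z"
    by (cases "z \<in> U") (simp_all add: dd_eqI[OF has_derivative_plus] dd_off)
qed

lemma dd_coord:
  "f \<in> HU U \<Longrightarrow> dd U j (\<lambda>z. z $ i * f z) = (\<lambda>z. z $ i * dd U j f z + (if i = j then f z else 0))"
proof
  fix z assume "f \<in> HU U"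
  then show "dd U j (\<lambda>z. z $ i * f z) z = z $ i * dd U j f z + (if i = j then f z else 0)"
    by (cases "z \<in> U") (simp_all only: dd_eqI[OF has_derivative_coord], auto simp: dd_off HU_off)
qed

lemma dd_zero: "dd U j (\<lambda>z. 0) = (\<lambda>z. 0)"
  using dd_cmult[OF HU_zero, of j 0] by simp

lemma dd_sum:
  assumes "\<And>i. i \<in> I \<Longrightarrow> f i \<in> HU U"
  shows "dd U j (\<lambda>z. \<Sum>i\<in>I. c i * f i z) = (\<lambda>z. \<Sum>i\<in>I. c i * dd U j (f i) z)"
  using assms
  by (induction I rule: infinite_finite_induct) (simp_all add: dd_zero dd_add dd_cmult HU_cmult HU_sum)

lemma dd_commute: "f \<in> HU U \<Longrightarrow> dd U i (dd U j f) = dd U j (dd U i f)"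
proof
  fix z assume f: "f \<in> HU U"
  show "dd U i (dd U j f) z = dd U j (dd U i f) z"
  proof (cases "z \<in> U")
    case True
    have "pd i (dd U j f) z = pd i (pd j f) z" for i j
      by (rule pd_cong_open[OF open_U True]) (simp add: dd_def)
    then show ?thesis
      using pd_commute[OF _ open_U True, of f i j] f by (simp add: dd_def[of U] True HU_def)
  qed (simp add: dd_off)
qed

section \<open>Higher derivatives indexed by exponent vectors\<close>

definition dfold :: "('n \<Rightarrow> nat) \<Rightarrow> 'n list \<Rightarrow> ((complex, 'n) vec \<Rightarrow> complex) \<Rightarrow> (complex, 'n) vec \<Rightarrow> complex" where
  "dfold a xs f = foldr (\<lambda>j g. (dd U j ^^ a j) g) xs f"

text \<open>Takes the coordinates in the order prescribed by \<open>pds\<close>;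
  \<open>dfold\<close> allows any list so that induction on the list is possible.\<close>

definition Dm :: "('n \<Rightarrow> nat) \<Rightarrow> ((complex, 'n) vec \<Rightarrow> complex) \<Rightarrow> (complex, 'n) vec \<Rightarrow> complex" where
  "Dm a f = dfold a (sorted_list_of_set UNIV) f"

lemma HU_dd_pow: "f \<in> HU U \<Longrightarrow> (dd U j ^^ k) f \<in> HU U"
  by (induction k) (auto intro: HU_dd)

lemma HU_dfold: "f \<in> HU U \<Longrightarrow> dfold a xs f \<in> HU U"
  by (induction xs) (auto simp: dfold_def intro: HU_dd_pow)

lemma HU_Dm: "f \<in> HU U \<Longrightarrow> Dm a f \<in> HU U"
  by (simp add: Dm_def HU_dfold)

lemma dd_pow_commute: "f \<in> HU U \<Longrightarrow> dd U i ((dd U j ^^ k) f) = (dd U j ^^ k) (dd U i f)"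
  by (induction k) (simp_all add: dd_commute[of _ i j] HU_dd_pow)

lemma dfold_dd: "f \<in> HU U \<Longrightarrow> dfold a xs (dd U i f) = dd U i (dfold a xs f)"
  by (induction xs) (simp_all add: dfold_def dd_pow_commute HU_dfold[unfolded dfold_def])

lemma dfold_dd_pow: "f \<in> HU U \<Longrightarrow> dfold a xs ((dd U i ^^ k) f) = (dd U i ^^ k) (dfold a xs f)"
  by (induction k) (simp_all add: dfold_dd HU_dd_pow)

lemma dfold_add: "f \<in> HU U \<Longrightarrow> dfold (a + b) xs f = dfold a xs (dfold b xs f)"
proof (induction xs)
  case Nil
  then show ?case by (simp add: dfold_def)
next
  case (Cons x xs)
  have "dfold (a + b) (x # xs) f = (dd U x ^^ (a x + b x)) (dfold (a + b) xs f)"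
    by (simp add: dfold_def)
  also have "\<dots> = (dd U x ^^ a x) ((dd U x ^^ b x) (dfold a xs (dfold b xs f)))"
    by (simp only: Cons.IH[OF Cons.prems] funpow_add o_apply)
  also have "\<dots> = (dd U x ^^ a x) (dfold a xs ((dd U x ^^ b x) (dfold b xs f)))"
    using Cons.prems by (simp add: dfold_dd_pow HU_dfold)
  also have "\<dots> = dfold a (x # xs) (dfold b (x # xs) f)"
    by (simp add: dfold_def)
  finally show ?case .
qed

lemma Dm_add: "f \<in> HU U \<Longrightarrow> Dm (a + b) f = Dm a (Dm b f)"
  by (simp add: Dm_def dfold_add)

lemma Dm_zero [simp]: "Dm 0 f = f"
proof -
  have "dfold 0 xs f = f" for xs by (induction xs) (simp_all add: dfold_def)
  then show ?thesis by (simp add: Dm_def)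
qed

definition unit :: "'n \<Rightarrow> 'n \<Rightarrow> nat" where
  "unit j = (\<lambda>i. if i = j then 1 else 0)"

lemma Dm_unit: "Dm (unit j) f = dd U j f"
proof -
  have "distinct xs \<Longrightarrow> dfold (unit j) xs f = (if j \<in> set xs then dd U j f else f)" for xs
    by (induction xs) (auto simp: dfold_def unit_def)
  from this[of "sorted_list_of_set UNIV"] show ?thesis by (simp add: Dm_def)
qed

text \<open>Induction on the total degree: a nonzero exponent vector has a positive entry, which is
  lowered by one.\<close>

lemma multi_index_induct [case_names zero step]:
  assumes "P 0" "\<And>a j. P a \<Longrightarrow> P (a + unit j)"
  shows "P a"
proof (induction "sum a UNIV" arbitrary: a)
  case 0
  then have "a = 0" by (auto simp: fun_eq_iff)
  then show ?case using assms(1) by (simp only:)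
next
  case (Suc n)
  then have "\<exists>j. a j \<noteq> 0" using sum.neutral[of UNIV a] by fastforce
  then obtain j where j: "a j > 0" by auto
  define b where "b = a(j := a j - 1)"
  have a: "a = b + unit j" using j by (auto simp: b_def unit_def fun_eq_iff)
  have "sum a UNIV = sum b UNIV + sum (unit j) UNIV" by (simp add: a sum.distrib)
  then have "n = sum b UNIV" using Suc(2) by (simp add: unit_def)
  then show ?case using assms(2)[OF Suc(1)] by (simp only: a)
qed

lemma Dm_step: "f \<in> HU U \<Longrightarrow> Dm (a + unit j) f = dd U j (Dm a f)"
  using Dm_add[of f "unit j" a] by (simp add: Dm_unit add.commute)

lemma Dm_sum:
  assumes "\<And>i. i \<in> I \<Longrightarrow> f i \<in> HU U"
  shows "Dm a (\<lambda>z. \<Sum>i\<in>I. c i * f i z) = (\<lambda>z. \<Sum>i\<in>I. c i * Dm a (f i) z)"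
  using assms by (induction a rule: multi_index_induct) (simp_all add: Dm_step HU_sum dd_sum HU_Dm)

lemma Dm_cmult: "f \<in> HU U \<Longrightarrow> Dm a (\<lambda>z. c * f z) = (\<lambda>z. c * Dm a f z)"
  using Dm_sum[of "{()}" "\<lambda>_. f" a "\<lambda>_. c"] by simp

text \<open>Links the derivatives in the definition of a solution to the cut-off ones: at a point of
  the open set U a derivative depends only on the values on U.\<close>

lemma pds_eq_Dm:
  assumes "f \<in> HU U" "z \<in> U" and fg: "\<And>z. z \<in> U \<Longrightarrow> g z = f z"
  shows "pds a g z = Dm a f z"
proof -
  have *: "\<forall>z\<in>U. (pd j ^^ k) g z = (dd U j ^^ k) f z" if "\<forall>z\<in>U. g z = f z" for g f j k
  proof (induction k)
    case (Suc k)
    then show ?case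
      using pd_cong_open[OF open_U, of _ "(pd j ^^ k) g" "(dd U j ^^ k) f" j] by (simp add: dd_def[of U j "_ f"])
  qed (use that in simp)
  have "\<forall>z\<in>U. foldr (\<lambda>j g. (pd j ^^ a j) g) xs g z = dfold a xs f z" for xs
  proof (induction xs)
    case (Cons x xs)
    from *[OF this] show ?case by (simp add: dfold_def)
  qed (simp add: fg dfold_def)
  then show ?thesis using assms(2) by (simp add: pds_def Dm_def)
qed

end

section \<open>Polynomials in the derivations and their ideals\<close>

abbreviation "lookup \<equiv> Poly_Mapping.lookup"
abbreviation "keys \<equiv> Poly_Mapping.keys"

text \<open>Exponents are moved into the integer vectors so that they can be subtracted and compared
  modulo L.\<close>

definition vecn :: "('n::finite \<Rightarrow> nat) \<Rightarrow> (int, 'n) vec" where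
  "vecn a = (\<chi> j. int (a j))"

lemma vecn_nth [simp]: "vecn a $ j = int (a j)"
  by (simp add: vecn_def)

lemma vecn_add: "vecn (a + b) = vecn a + vecn b"
  by (simp add: vec_eq_iff)

lemma vecn_zero [simp]: "vecn 0 = 0"
  by (simp add: vec_eq_iff)

lemma pos_neg_part: "vecn (pos_part u) = vecn (neg_part u) + u"
  by (simp add: vec_eq_iff pos_part_def neg_part_def)

text \<open>The degree of the monomial \<partial>^w in the grading by A, made complex because it is
  subtracted from \<beta>.\<close>

definition cdeg :: "((int, 'n::finite) vec, 'k::finite) vec \<Rightarrow> (int, 'n) vec \<Rightarrow> (complex, 'k) vec" where
  "cdeg A w = (\<chi> k. of_int ((A *v w) $ k))"

lemma cdeg_add: "cdeg A (v + w) = cdeg A v + cdeg A w"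
  by (simp add: cdeg_def vec_eq_iff matrix_vector_right_distrib)

lemma cdeg_zero [simp]: "cdeg A 0 = 0"
  by (simp add: cdeg_def vec_eq_iff)

lemma cdeg_axis: "cdeg A (axis j 1) $ k = of_int (A $ k $ j)"
  by (simp add: cdeg_def matrix_vector_mult_def axis_def if_distrib[of "\<lambda>x. _ * x"] cong: if_cong)

lemma latL_add: "u \<in> latL A \<Longrightarrow> v \<in> latL A \<Longrightarrow> u + v \<in> latL A"
  by (simp add: latL_def matrix_vector_right_distrib)

lemma latL_minus: "u \<in> latL A \<Longrightarrow> - u \<in> latL A" for A :: "((int, 'n::finite) vec, 'k::finite) vec"
  using matrix_vector_mult_diff_distrib[of A 0 u] by (simp add: latL_def)

lemma latL_diff: "u \<in> latL A \<Longrightarrow> v \<in> latL A \<Longrightarrow> u - v \<in> latL A" for A :: "((int, 'n::finite) vec, 'k::finite) vec"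
  by (simp add: latL_def matrix_vector_mult_diff_distrib)

lemma latL_zero [simp]: "0 \<in> latL A"
  by (simp add: latL_def)

lemma cdeg_latL: "u \<in> latL A \<Longrightarrow> cdeg A u = 0"
  by (simp add: latL_def cdeg_def vec_eq_iff)

lemma cdeg_cong_latL:
  fixes A :: "((int, 'n::finite) vec, 'k::finite) vec"
  assumes "v - w \<in> latL A"
  shows "cdeg A v = cdeg A w"
  using cdeg_add[of A w "v - w"] cdeg_latL[OF assms] by simp

text \<open>There is no separate zero case, since \<open>Poly_Mapping.single a 0\<close> is the zero
  polynomial.\<close>

lemma poly_mapping_add_induct [case_names single add]:
  assumes single: "\<And>a c. R (Poly_Mapping.single a c)" and add: "\<And>P Q. R P \<Longrightarrow> R Q \<Longrightarrow> R (P + Q)"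
  shows "R (P :: 'a \<Rightarrow>\<^sub>0 'b::monoid_add)"
proof (induction P rule: update_induct)
  case const
  show ?case using single[of undefined 0] by simp
next
  case (update f a b)
  have "Poly_Mapping.update a b f = f + Poly_Mapping.single a b"
    using update(1) by (intro poly_mapping_eqI)
      (auto simp: lookup_update lookup_add lookup_single when_def not_in_keys_iff_lookup_eq_zero)
  then show ?case using add[OF update(3) single] by simp
qed

text \<open>Linear extension of h from monomials to polynomials. With the derivatives of f at a
  point as h it gives the action of operators; with shifted characters as h, functionals vanishing
  on I_\<rho>.\<close>

definition lext :: "('a \<Rightarrow> complex) \<Rightarrow> ('a \<Rightarrow>\<^sub>0 complex) \<Rightarrow> complex" where
  "lext h P = (\<Sum>a\<in>keys P. lookup P a * h a)"

lemma lext_superset: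
  assumes "finite S" "keys P \<subseteq> S"
  shows "lext h P = (\<Sum>a\<in>S. lookup P a * h a)"
  unfolding lext_def using assms
  by (intro sum.mono_neutral_left) (auto simp: not_in_keys_iff_lookup_eq_zero)

lemma lext_add: "lext h (P + Q) = lext h P + lext h Q"
  using lext_superset[of "keys P \<union> keys Q" "P + Q" h] lext_superset[of "keys P \<union> keys Q" P h]
    lext_superset[of "keys P \<union> keys Q" Q h] keys_add[of P Q]
  by (simp add: lookup_add distrib_right sum.distrib)

lemma lext_single: "lext h (Poly_Mapping.single a c) = c * h a"
  using lext_superset[of "{a}" "Poly_Mapping.single a c" h] by simp

lemma lext_zero: "lext h 0 = 0"
  by (simp add: lext_def)

lemma lext_uminus: "lext h (- P) = - lext h P"
  by (simp add: lext_def sum_negf)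

lemma lext_diff: "lext h (P - Q) = lext h P - lext h Q"
  using lext_add[of h P "- Q"] by (simp add: lext_uminus)

text \<open>The counterpart of \<open>dpoly\<close> with finite support built in, which provides the
  ring structure; \<open>lookup\<close> leads back to coefficient functions.\<close>

type_synonym 'n ppoly = "('n \<Rightarrow> nat) \<Rightarrow>\<^sub>0 complex"

text \<open>Identifies the closure rule \<open>mult\<close> of \<open>dideal\<close> with
  multiplication by a monomial; sums then give closure under all polynomial multiples.\<close>

lemma lookup_single_times:
  fixes P :: "'n ppoly"
  shows "lookup (Poly_Mapping.single a c * P) = dshift c a (lookup P)"
proof (induction P rule: poly_mapping_add_induct)
  case (single b d)
  have "x = a + b \<longleftrightarrow> (\<forall>j. a j \<le> x j) \<and> (\<lambda>j. x j - a j) = b" for x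
    by (fastforce simp: fun_eq_iff)
  then have "lookup (Poly_Mapping.single a c * Poly_Mapping.single b d) x
      = dshift c a (lookup (Poly_Mapping.single b d)) x" for x
    unfolding mult_single dshift_def lookup_single when_def by (cases "x = a + b"; cases "\<forall>j. a j \<le> x j") (simp_all, metis+)
  then show ?case by blast
next
  case (add P Q)
  then show ?case by (auto simp: distrib_left lookup_add dshift_def fun_eq_iff)
qed

section \<open>Binomials and ideals inside the polynomial ring\<close>

definition binomP :: "(int, 'n::finite) vec \<Rightarrow> complex \<Rightarrow> 'n ppoly" where
  "binomP u c = Poly_Mapping.single (pos_part u) 1 - Poly_Mapping.single (neg_part u) c"

lemma lookup_binomP: "lookup (binomP u c) = binom u c"
  by (auto simp: binomP_def binom_def dmonom_def lookup_minus lookup_single when_def)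

lemma lookup_add_dideal:
  "lookup P \<in> dideal S \<Longrightarrow> lookup Q \<in> dideal S \<Longrightarrow> lookup (P + Q) \<in> dideal S"
proof -
  assume "lookup P \<in> dideal S" "lookup Q \<in> dideal S"
  moreover have "lookup (P + Q) = (\<lambda>b. lookup P b + lookup Q b)" by (simp add: lookup_add fun_eq_iff)
  ultimately show ?thesis by (simp add: dideal.add)
qed

lemma lookup_mult_dideal:
  fixes P Q :: "'n ppoly"
  shows "lookup P \<in> dideal S \<Longrightarrow> lookup (Q * P) \<in> dideal S"
  by (induction Q rule: poly_mapping_add_induct)
    (simp_all add: lookup_single_times dideal.mult distrib_right lookup_add_dideal)

lemma lookup_minus_dideal:
  fixes P :: "'n ppoly"
  assumes "lookup P \<in> dideal S"
  shows "lookup (- P) \<in> dideal S"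
  using lookup_mult_dideal[OF assms, of "- 1"] by simp

lemma lookup_diff_dideal:
  fixes P :: "'n ppoly"
  assumes "lookup P \<in> dideal S" "lookup Q \<in> dideal S"
  shows "lookup (P - Q) \<in> dideal S"
  using lookup_add_dideal[OF assms(1) lookup_minus_dideal[OF assms(2)]] by simp

lemma lookup_zero_dideal: "lookup 0 \<in> dideal S"
  using dideal.zero[of S] by (simp add: zero_poly_mapping.rep_eq)

lemma lookup_sum_dideal:
  fixes P :: "'i \<Rightarrow> 'n ppoly"
  assumes "\<And>i. i \<in> I \<Longrightarrow> lookup (P i) \<in> dideal S"
  shows "lookup (\<Sum>i\<in>I. P i) \<in> dideal S"
  using assms by (induction I rule: infinite_finite_induct) (auto intro: lookup_add_dideal lookup_zero_dideal)

lemma finite_binom: "finite {a. binom u c a \<noteq> 0}"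
  using finite_lookup[of "binomP u c"] by (simp add: lookup_binomP)

lemma finite_dideal:
  assumes "\<And>p. p \<in> S \<Longrightarrow> finite {a. p a \<noteq> 0}" "p \<in> dideal S"
  shows "finite {a. p a \<noteq> 0}"
  using assms(2)
proof induction
  case (gen p)
  then show ?case using assms(1) by simp
next
  case zero
  then show ?case by simp
next
  case (add p q)
  then have "finite ({a. p a \<noteq> 0} \<union> {a. q a \<noteq> 0})" by simp
  then show ?case by (rule rev_finite_subset) auto
next
  case (mult p c a)
  have "lookup (Poly_Mapping.single a c * Abs_poly_mapping p) = dshift c a p"
    using mult(2) by (simp add: lookup_single_times)
  then show ?case using finite_lookup[of "Poly_Mapping.single a c * Abs_poly_mapping p"] by simp
qed

text \<open>Transfers rule induction on \<open>dideal\<close> to polynomials. Finite support of the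
  generators guarantees that every element met in the induction is the coefficient function of a
  polynomial.\<close>

lemma dideal_lookup_induct:
  fixes P :: "'n ppoly"
  assumes S: "\<And>p. p \<in> S \<Longrightarrow> finite {a. p a \<noteq> 0}" and P: "lookup P \<in> dideal S"
    and gen: "\<And>P. lookup P \<in> S \<Longrightarrow> R P" and zero: "R 0"
    and add: "\<And>P Q. R P \<Longrightarrow> R Q \<Longrightarrow> R (P + Q)"
    and mult: "\<And>P a c. R P \<Longrightarrow> R (Poly_Mapping.single a c * P)"
  shows "R P"
proof -
  have "\<forall>P. lookup P = p \<longrightarrow> R P" if "p \<in> dideal S" for p
    using that
  proof induction
    case (gen p)
    then show ?case using assms(3) by auto
  next
    case zero
    have "P = 0" if "lookup P = (\<lambda>_. 0)" for P :: "'n ppoly"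
      using that by (intro poly_mapping_eqI) simp
    then show ?case using assms(4) by blast
  next
    case (add p q)
    have *: "lookup (Abs_poly_mapping p) = p" "lookup (Abs_poly_mapping q) = q"
      using finite_dideal[OF S] add(1,2) by auto
    have "P = Abs_poly_mapping p + Abs_poly_mapping q" if "lookup P = (\<lambda>b. p b + q b)" for P
      using that by (intro poly_mapping_eqI) (simp add: lookup_add *)
    moreover have "R (Abs_poly_mapping p)" "R (Abs_poly_mapping q)"
      using add.IH * by blast+
    ultimately show ?case using assms(5) by blast
  next
    case (mult p c a)
    have *: "lookup (Abs_poly_mapping p) = p"
      using finite_dideal[OF S] mult(1) by auto
    have "P = Poly_Mapping.single a c * Abs_poly_mapping p" if "lookup P = dshift c a p" for P
      using that by (intro poly_mapping_eqI) (simp add: lookup_single_times *)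
    moreover have "R (Abs_poly_mapping p)" using mult.IH * by blast
    ultimately show ?case using assms(6) by blast
  qed
  then show ?thesis using P by blast
qed

section \<open>Operators separating finitely many characters\<close>

lemma binomP_I_rho: "u \<in> latL A \<Longrightarrow> lookup (binomP u (\<rho> u)) \<in> I_rho A \<rho>"
  unfolding I_rho_def lookup_binomP by (intro dideal.gen) blast

text \<open>Homogeneity for the grading by the classes modulo L. Such an operator shifts the
  parameter of the Euler equations by a single amount.\<close>

definition homog :: "((int, 'n::finite) vec, 'k::finite) vec \<Rightarrow> ('n \<Rightarrow> nat) \<Rightarrow> 'n ppoly \<Rightarrow> bool" where
  "homog A \<alpha> P \<longleftrightarrow> (\<forall>a\<in>keys P. vecn a - vecn \<alpha> \<in> latL A)"

lemma homog_mult: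
  fixes A :: "((int, 'n::finite) vec, 'k::finite) vec"
  assumes "homog A \<alpha> P" "homog A \<beta> Q"
  shows "homog A (\<alpha> + \<beta>) (P * Q)"
  unfolding homog_def
proof
  fix c assume "c \<in> keys (P * Q)"
  then obtain a b where c: "c = a + b" "a \<in> keys P" "b \<in> keys Q" using keys_mult by blast
  have "vecn c - vecn (\<alpha> + \<beta>) = (vecn a - vecn \<alpha>) + (vecn b - vecn \<beta>)"
    by (simp add: c vecn_add)
  then show "vecn c - vecn (\<alpha> + \<beta>) \<in> latL A"
    using assms c by (auto simp: homog_def intro: latL_add)
qed

lemma homog_single: "homog A \<alpha> (Poly_Mapping.single \<alpha> c)"
  by (simp add: homog_def)

lemma homog_binomP:
  fixes A :: "((int, 'n::finite) vec, 'k::finite) vec"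
  assumes "u \<in> latL A"
  shows "homog A (neg_part u) (binomP u c)"
proof -
  have "keys (binomP u c) \<subseteq> {pos_part u, neg_part u}"
    using keys_diff[of "Poly_Mapping.single (pos_part u) (1::complex)" "Poly_Mapping.single (neg_part u) c"]
    by (auto simp: binomP_def split: if_splits)
  then show ?thesis using assms by (auto simp: homog_def pos_neg_part)
qed

text \<open>One factor per character \<rho>' in J: a scaled binomial that lies in I_\<rho>' and is a
  monomial modulo I_\<rho>. The exponent \<alpha> collects these monomials.\<close>

lemma exists_separating_poly:
  fixes A :: "((int, 'n::finite) vec, 'k::finite) vec"
  assumes "finite J" "J \<subseteq> charG A B" "\<rho> \<in> charG A B" "\<rho> \<notin> J"
  shows "\<exists>\<alpha> P. (\<forall>\<rho>'\<in>J. lookup P \<in> I_rho A \<rho>') \<and> homog A \<alpha> P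
      \<and> lookup (P - Poly_Mapping.single \<alpha> 1) \<in> I_rho A \<rho>"
  using assms(1,2,4)
proof (induction J)
  case empty
  show ?case
    by (rule exI[of _ 0], rule exI[of _ "Poly_Mapping.single 0 1"])
      (simp only: homog_single I_rho_def diff_self lookup_zero_dideal ball_simps simp_thms)
next
  case (insert \<rho>' J)
  then obtain \<alpha> P where P: "\<forall>\<rho>'\<in>J. lookup P \<in> I_rho A \<rho>'" "homog A \<alpha> P"
      "lookup (P - Poly_Mapping.single \<alpha> 1) \<in> I_rho A \<rho>"
    by auto
  have "\<rho> \<noteq> \<rho>'" using insert by auto
  then obtain u where "\<rho> u \<noteq> \<rho>' u" by blast
  \<comment> \<open>By convention both characters vanish outside L, so a point where they differ
    lies in L.\<close>
  moreover have "\<rho> u = 0" "\<rho>' u = 0" if "u \<notin> latL A"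
    using that insert assms(3) by (auto simp: charG_def)
  ultimately have u: "u \<in> latL A" "\<rho> u - \<rho>' u \<noteq> 0" by force+
  define k where "k = Poly_Mapping.single (0 :: 'n \<Rightarrow> nat) (1 / (\<rho> u - \<rho>' u))"
  \<comment> \<open>Modulo I_\<rho> the monomial with exponent u_+ becomes \<rho>(u) times the one
    with exponent u_-, so the scaled binomial of \<rho>' becomes the monomial with exponent
    u_-.\<close>
  define Q where "Q = k * binomP u (\<rho>' u)"
  have Q: "Q - Poly_Mapping.single (neg_part u) 1 = k * binomP u (\<rho> u)"
    using u(2) by (simp add: Q_def k_def binomP_def right_diff_distrib mult_single diff_diff_eq
        flip: single_add single_diff add_divide_distrib) (simp add: field_simps)
  have "lookup (P * Q) \<in> I_rho A \<sigma>" if "\<sigma> \<in> insert \<rho>' J" for \<sigma>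
  proof (cases "\<sigma> = \<rho>'")
    case True
    then show ?thesis using binomP_I_rho[OF u(1), of \<rho>']
      by (simp add: I_rho_def Q_def lookup_mult_dideal)
  next
    case False
    then show ?thesis using P(1) that lookup_mult_dideal[of P _ Q]
      by (auto simp: I_rho_def mult.commute)
  qed
  moreover have "homog A (\<alpha> + neg_part u) (P * Q)"
    using homog_mult[OF P(2) homog_mult[OF homog_single[of A 0] homog_binomP[OF u(1)]]]
    by (simp add: Q_def k_def)
  moreover have "P * Q - Poly_Mapping.single (\<alpha> + neg_part u) 1
      = Q * (P - Poly_Mapping.single \<alpha> 1) + Poly_Mapping.single \<alpha> 1 * (k * binomP u (\<rho> u))"
    unfolding Q[symmetric] by (simp add: algebra_simps mult_single)
  then have "lookup (P * Q - Poly_Mapping.single (\<alpha> + neg_part u) 1) \<in> I_rho A \<rho>"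
    using P(3) binomP_I_rho[OF u(1), of \<rho>]
    by (simp add: I_rho_def lookup_mult_dideal lookup_add_dideal)
  ultimately show ?case by blast
qed

text \<open>The operators of \<open>exists_separating_poly\<close> come with different exponents.
  Multiplying each by the monomial of all the other exponents makes the exponent common, as needed
  for a single index set.\<close>

lemma exists_separating_family:
  fixes A :: "((int, 'n::finite) vec, 'k::finite) vec"
  assumes "finite J" "J \<subseteq> charG A B"
  shows "\<exists>\<alpha> P. \<forall>\<rho>\<in>J. (\<forall>\<rho>'\<in>J - {\<rho>}. lookup (P \<rho>) \<in> I_rho A \<rho>') \<and> homog A \<alpha> (P \<rho>)
      \<and> lookup (P \<rho> - Poly_Mapping.single \<alpha> 1) \<in> I_rho A \<rho>"
proof -
  have "\<forall>\<rho>\<in>J. \<exists>\<alpha> P. (\<forall>\<rho>'\<in>J - {\<rho>}. lookup P \<in> I_rho A \<rho>') \<and> homog A \<alpha> P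
      \<and> lookup (P - Poly_Mapping.single \<alpha> 1) \<in> I_rho A \<rho>"
    using assms by (intro ballI exists_separating_poly) auto
  then obtain \<alpha> where "\<forall>\<rho>\<in>J. \<exists>P. (\<forall>\<rho>'\<in>J - {\<rho>}. lookup P \<in> I_rho A \<rho>') \<and> homog A (\<alpha> \<rho>) P
      \<and> lookup (P - Poly_Mapping.single (\<alpha> \<rho>) 1) \<in> I_rho A \<rho>"
    unfolding bchoice_iff[of J] by blast
  then obtain P where P: "\<forall>\<rho>\<in>J. (\<forall>\<rho>'\<in>J - {\<rho>}. lookup (P \<rho>) \<in> I_rho A \<rho>') \<and> homog A (\<alpha> \<rho>) (P \<rho>)
      \<and> lookup (P \<rho> - Poly_Mapping.single (\<alpha> \<rho>) 1) \<in> I_rho A \<rho>"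
    unfolding bchoice_iff[of J] by blast
  define m where "m \<rho> = (\<Sum>\<sigma>\<in>J - {\<rho>}. \<alpha> \<sigma>)" for \<rho>
  have m: "m \<rho> + \<alpha> \<rho> = (\<Sum>\<sigma>\<in>J. \<alpha> \<sigma>)" if "\<rho> \<in> J" for \<rho>
    using that assms(1) by (simp add: m_def sum.remove[of J \<rho>] add.commute)
  define Q where "Q \<rho> = Poly_Mapping.single (m \<rho>) 1 * P \<rho>" for \<rho>
  have "(\<forall>\<rho>'\<in>J - {\<rho>}. lookup (Q \<rho>) \<in> I_rho A \<rho>') \<and> homog A (\<Sum>\<sigma>\<in>J. \<alpha> \<sigma>) (Q \<rho>)
      \<and> lookup (Q \<rho> - Poly_Mapping.single (\<Sum>\<sigma>\<in>J. \<alpha> \<sigma>) 1) \<in> I_rho A \<rho>" if \<rho>: "\<rho> \<in> J" for \<rho>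
  proof (intro conjI ballI)
    show "lookup (Q \<rho>) \<in> I_rho A \<rho>'" if "\<rho>' \<in> J - {\<rho>}" for \<rho>'
      using P \<rho> that by (auto simp: I_rho_def Q_def lookup_mult_dideal)
    show "homog A (\<Sum>\<sigma>\<in>J. \<alpha> \<sigma>) (Q \<rho>)"
      unfolding m[OF \<rho>, symmetric] Q_def using P \<rho> homog_mult homog_single by blast
    have "Q \<rho> - Poly_Mapping.single (\<Sum>\<sigma>\<in>J. \<alpha> \<sigma>) 1
        = Poly_Mapping.single (m \<rho>) 1 * (P \<rho> - Poly_Mapping.single (\<alpha> \<rho>) 1)"
      unfolding m[OF \<rho>, symmetric] Q_def by (simp only: right_diff_distrib mult_single mult_1)
    then show "lookup (Q \<rho> - Poly_Mapping.single (\<Sum>\<sigma>\<in>J. \<alpha> \<sigma>) 1) \<in> I_rho A \<rho>"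
      using P \<rho> by (simp add: I_rho_def lookup_mult_dideal)
  qed
  then show ?thesis by blast
qed

section \<open>Euler equations and the action of polynomials in the derivations\<close>

context open_dom
begin

lemma vecn_unit: "vecn (unit j) = axis j 1"
  by (simp add: vec_eq_iff unit_def axis_def)

text \<open>All z are allowed: for functions in \<open>HU U\<close> both sides vanish outside U, so
  the condition concerns U only.\<close>

definition Eul :: "((int, 'n) vec, 'k::finite) vec \<Rightarrow> (complex, 'k) vec \<Rightarrow> ((complex, 'n) vec \<Rightarrow> complex) \<Rightarrow> bool" where
  "Eul A \<beta> f \<longleftrightarrow> (\<forall>k z. (\<Sum>i\<in>UNIV. of_int (A $ k $ i) * (z $ i * dd U i f z)) = \<beta> $ k * f z)"

text \<open>Moving \<partial>_j past x_j \<partial>_j produces one extra \<partial>_j, which lowers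
  the parameter by the j-th column of A.\<close>

lemma Eul_dd:
  assumes f: "f \<in> HU U" and E: "Eul A \<beta> f"
  shows "Eul A (\<beta> - cdeg A (axis j 1)) (dd U j f)"
  unfolding Eul_def
proof (intro allI)
  fix k z
  have "(\<lambda>z. \<Sum>i\<in>UNIV. of_int (A $ k $ i) * (z $ i * dd U i f z)) = (\<lambda>z. \<beta> $ k * f z)"
    using E by (simp add: Eul_def)
  then have "dd U j (\<lambda>z. \<Sum>i\<in>UNIV. of_int (A $ k $ i) * (z $ i * dd U i f z)) z = dd U j (\<lambda>z. \<beta> $ k * f z) z"
    by simp
  then have "(\<Sum>i\<in>UNIV. of_int (A $ k $ i) * (z $ i * dd U j (dd U i f) z + (if i = j then dd U i f z else 0)))
      = \<beta> $ k * dd U j f z"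
    using f by (simp add: dd_sum dd_cmult dd_coord HU_coord HU_dd)
  then have "(\<Sum>i\<in>UNIV. of_int (A $ k $ i) * (z $ i * dd U j (dd U i f) z)) + of_int (A $ k $ j) * dd U j f z
      = \<beta> $ k * dd U j f z"
    by (simp add: distrib_left sum.distrib if_distrib[of "\<lambda>x. _ * x"] cong: if_cong)
  then show "(\<Sum>i\<in>UNIV. of_int (A $ k $ i) * (z $ i * dd U i (dd U j f) z))
      = (\<beta> - cdeg A (axis j 1)) $ k * dd U j f z"
    using f by (simp add: dd_commute[of f _ j] cdeg_axis algebra_simps)
qed

text \<open>The opposite shift: differentiating the factor x_j raises the parameter by the j-th
  column.\<close>

lemma Eul_coord:
  assumes f: "f \<in> HU U" and E: "Eul A \<beta> f"
  shows "Eul A (\<beta> + cdeg A (axis j 1)) (\<lambda>z. z $ j * f z)"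
  unfolding Eul_def
proof (intro allI)
  fix k z
  have "(\<Sum>i\<in>UNIV. of_int (A $ k $ i) * (z $ i * dd U i (\<lambda>z. z $ j * f z) z))
      = (\<Sum>i\<in>UNIV. z $ j * (of_int (A $ k $ i) * (z $ i * dd U i f z))
          + (if j = i then of_int (A $ k $ j) * (z $ j * f z) else 0))"
    using f by (intro sum.cong refl) (simp add: dd_coord, simp add: algebra_simps)
  also have "\<dots> = z $ j * (\<Sum>i\<in>UNIV. of_int (A $ k $ i) * (z $ i * dd U i f z)) + of_int (A $ k $ j) * (z $ j * f z)"
    by (simp add: sum.distrib sum_distrib_left)
  also have "\<dots> = (\<beta> + cdeg A (axis j 1)) $ k * (z $ j * f z)"
    using E by (simp add: Eul_def cdeg_axis algebra_simps)
  finally show "(\<Sum>i\<in>UNIV. of_int (A $ k $ i) * (z $ i * dd U i (\<lambda>z. z $ j * f z) z))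
      = (\<beta> + cdeg A (axis j 1)) $ k * (z $ j * f z)" .
qed

lemma Eul_sum:
  assumes f: "\<And>i. i \<in> I \<Longrightarrow> f i \<in> HU U" and E: "\<And>i. i \<in> I \<Longrightarrow> Eul A \<beta> (f i)"
  shows "Eul A \<beta> (\<lambda>z. \<Sum>i\<in>I. c i * f i z)"
  unfolding Eul_def
proof (intro allI)
  fix k z
  have "(\<Sum>i\<in>UNIV. of_int (A $ k $ i) * (z $ i * dd U i (\<lambda>z. \<Sum>i\<in>I. c i * f i z) z))
      = (\<Sum>i\<in>UNIV. \<Sum>l\<in>I. c l * (of_int (A $ k $ i) * (z $ i * dd U i (f l) z)))"
    using f by (simp add: dd_sum sum_distrib_left mult_ac)
  also have "\<dots> = (\<Sum>l\<in>I. c l * (\<Sum>i\<in>UNIV. of_int (A $ k $ i) * (z $ i * dd U i (f l) z)))"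
    by (subst sum.swap) (simp add: sum_distrib_left)
  also have "\<dots> = (\<Sum>l\<in>I. c l * (\<beta> $ k * f l z))"
    using E by (intro sum.cong) (auto simp: Eul_def)
  also have "\<dots> = \<beta> $ k * (\<Sum>i\<in>I. c i * f i z)" by (simp add: sum_distrib_left mult_ac)
  finally show "(\<Sum>i\<in>UNIV. of_int (A $ k $ i) * (z $ i * dd U i (\<lambda>z. \<Sum>i\<in>I. c i * f i z) z))
      = \<beta> $ k * (\<Sum>i\<in>I. c i * f i z)" .
qed

lemma Eul_Dm:
  assumes f: "f \<in> HU U" and E: "Eul A \<beta> f"
  shows "Eul A (\<beta> - cdeg A (vecn a)) (Dm a f)"
proof (induction a rule: multi_index_induct)
  case zero
  show ?case using E by (simp only: Dm_zero vecn_zero cdeg_zero diff_zero)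
next
  case (step a j)
  have "Eul A (\<beta> - cdeg A (vecn a) - cdeg A (axis j 1)) (dd U j (Dm a f))"
    by (rule Eul_dd) (use step f in \<open>auto intro: HU_Dm\<close>)
  then show ?case using f by (simp only: Dm_step vecn_add vecn_unit cdeg_add diff_diff_eq)
qed

definition opP :: "'n ppoly \<Rightarrow> ((complex, 'n) vec \<Rightarrow> complex) \<Rightarrow> (complex, 'n) vec \<Rightarrow> complex" where
  "opP P f = (\<lambda>z. lext (\<lambda>a. Dm a f z) P)"

lemma Dm_plus: "f \<in> HU U \<Longrightarrow> g \<in> HU U \<Longrightarrow> Dm a (\<lambda>z. f z + g z) = (\<lambda>z. Dm a f z + Dm a g z)"
  by (induction a rule: multi_index_induct) (simp_all add: Dm_step HU_add dd_add HU_Dm)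

lemma opP_add: "opP (P + Q) f = (\<lambda>z. opP P f z + opP Q f z)"
  by (simp add: opP_def lext_add)

lemma opP_single: "opP (Poly_Mapping.single a c) f = (\<lambda>z. c * Dm a f z)"
  by (simp add: opP_def lext_single)

lemma HU_opP: "f \<in> HU U \<Longrightarrow> opP P f \<in> HU U"
  unfolding opP_def lext_def by (intro HU_sum HU_Dm)

lemma opP_diff: "opP (P - Q) f = (\<lambda>z. opP P f z - opP Q f z)"
  by (simp add: opP_def lext_diff)

lemma opP_zero: "opP 0 f = (\<lambda>z. 0)"
  by (simp add: opP_def lext_zero)

lemma opP_sum: "opP (\<Sum>i\<in>I. P i) f = (\<lambda>z. \<Sum>i\<in>I. opP (P i) f z)"
  by (induction I rule: infinite_finite_induct) (simp_all add: opP_zero opP_add)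

lemma opP_cmult: "f \<in> HU U \<Longrightarrow> opP P (\<lambda>z. c * f z) = (\<lambda>z. c * opP P f z)"
  unfolding opP_def lext_def by (simp add: Dm_cmult sum_distrib_left mult_ac)

lemma opP_mult: "f \<in> HU U \<Longrightarrow> opP (P * Q) f = opP P (opP Q f)"
proof (induction P rule: poly_mapping_add_induct)
  case (single a c)
  then show ?case
  proof (induction Q rule: poly_mapping_add_induct)
    case (single b d)
    then show ?case by (simp add: mult_single opP_single Dm_add Dm_cmult HU_Dm mult_ac)
  next
    case (add P Q)
    then show ?case
      by (simp add: distrib_left opP_add opP_single HU_opP Dm_plus)
  qed
next
  case (add P Q)
  then show ?case by (simp add: distrib_right opP_add)
qed

lemma dapply_eq_opP:
  assumes "f \<in> HU U" "z \<in> U" "\<And>z. z \<in> U \<Longrightarrow> g z = f z"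
  shows "dapply (lookup P) g z = opP P f z"
  using pds_eq_Dm[OF assms] by (simp add: dapply_def opP_def lext_def keys.rep_eq)

text \<open>All monomials of P have the degree of \<alpha>, so each shifts the parameter by the same
  amount.\<close>

lemma Eul_opP:
  assumes f: "f \<in> HU U" and E: "Eul A \<beta> f" and P: "homog A \<alpha> P"
  shows "Eul A (\<beta> - cdeg A (vecn \<alpha>)) (opP P f)"
  unfolding opP_def lext_def
proof (rule Eul_sum)
  fix a assume "a \<in> keys P"
  then have "cdeg A (vecn a) = cdeg A (vecn \<alpha>)"
    using P by (intro cdeg_cong_latL) (simp add: homog_def)
  then show "Eul A (\<beta> - cdeg A (vecn \<alpha>)) (Dm a f)" using Eul_Dm[OF f E, of a] by simp
qed (use f in \<open>auto intro: HU_Dm\<close>)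

text \<open>The polynomials annihilating f form an ideal, so it suffices to look at
  generators.\<close>

lemma dideal_kills:
  assumes f: "f \<in> HU U" and S: "\<And>p. p \<in> S \<Longrightarrow> finite {a. p a \<noteq> 0}"
    and kill: "\<And>P. lookup P \<in> S \<Longrightarrow> opP P f = (\<lambda>z. 0)" and P: "lookup P \<in> dideal S"
  shows "opP P f = (\<lambda>z. 0)"
proof (rule dideal_lookup_induct[OF S P])
  fix Q :: "'n ppoly" and a c assume Q: "opP Q f = (\<lambda>z. 0)"
  have "Dm a (\<lambda>z. 0) = (\<lambda>z. 0)" using Dm_cmult[OF HU_zero, of a 0] by simp
  then show "opP (Poly_Mapping.single a c * Q) f = (\<lambda>z. 0)"
    using Q f opP_mult[of f "Poly_Mapping.single a c" Q] by (simp add: opP_single)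
qed (simp_all add: kill opP_zero opP_add)

end

section \<open>Extension of families of solutions\<close>

text \<open>The value of the real linear form l on the j-th column of A; \<open>lamC\<close> is the
  same form on complex parameters.\<close>

definition lamA :: "((int, 'n::finite) vec, 'k::finite) vec \<Rightarrow> (real, 'k) vec \<Rightarrow> 'n \<Rightarrow> real" where
  "lamA A l j = (\<Sum>k\<in>UNIV. l $ k * of_int (A $ k $ j))"

definition lamC :: "(real, 'k::finite) vec \<Rightarrow> (complex, 'k) vec \<Rightarrow> complex" where
  "lamC l b = (\<Sum>k\<in>UNIV. of_real (l $ k) * b $ k)"

lemma lamC_diff: "lamC l (b - c) = lamC l b - lamC l c"
  by (simp add: lamC_def right_diff_distrib sum_subtractf)

lemma lamC_cdeg_axis: "lamC l (cdeg A (axis j 1)) = of_real (lamA A l j)"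
  by (simp add: lamC_def lamA_def cdeg_axis)

text \<open>Dual way of saying that the columns indexed by \<sigma> span the real k-space; its
  negation directly supplies a nonzero form l for the extension step.\<close>

definition spanning :: "((int, 'n::finite) vec, 'k::finite) vec \<Rightarrow> 'n set \<Rightarrow> bool" where
  "spanning A \<sigma> \<longleftrightarrow> (\<forall>l. (\<forall>j\<in>\<sigma>. lamA A l j = 0) \<longrightarrow> l = 0)"

section \<open>Character rules and congruent monomials\<close>

context
  fixes A :: "((int, 'n::finite) vec, 'k::finite) vec" and B :: "((int, 'm::finite) vec, 'n) vec"
    and \<rho> :: "(int, 'n) vec \<Rightarrow> complex"
  assumes \<rho>: "\<rho> \<in> charG A B"
begin

lemma char_zero: "\<rho> 0 = 1"
proof -
  have "0 = B *v 0" by simp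
  then have "(0 :: (int, 'n) vec) \<in> latB B" unfolding latB_def by blast
  then show ?thesis using \<rho> by (simp add: charG_def)
qed

lemma char_add: "u \<in> latL A \<Longrightarrow> v \<in> latL A \<Longrightarrow> \<rho> (u + v) = \<rho> u * \<rho> v"
  using \<rho> by (simp add: charG_def)

lemma char_latB: "u \<in> latB B \<Longrightarrow> \<rho> u = 1"
  using \<rho> by (simp add: charG_def)

end

text \<open>The common part c is the componentwise minimum of a and b; what exceeds it is u_+ on one
  side and u_- on the other.\<close>

lemma shift_decomp:
  fixes u :: "(int, 'n::finite) vec"
  assumes "vecn a = vecn b + u"
  obtains c where "a = c + pos_part u" "b = c + neg_part u"
proof
  have *: "int (a j) = int (b j) + u $ j" for j
    using arg_cong[OF assms, of "\<lambda>v. v $ j"] by simp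
  have "a j = min (a j) (b j) + nat (u $ j)" "b j = min (a j) (b j) + nat (- (u $ j))" for j
    using *[of j] by linarith+
  then show "a = (\<lambda>j. min (a j) (b j)) + pos_part u" "b = (\<lambda>j. min (a j) (b j)) + neg_part u"
    unfolding fun_eq_iff pos_part_def neg_part_def plus_fun_apply by blast+
qed

lemma single_diff_single:
  fixes u :: "(int, 'n::finite) vec"
  assumes "vecn a = vecn b + u"
  shows "\<exists>Q. Poly_Mapping.single a 1 - Poly_Mapping.single b x = Q * binomP u x"
proof -
  obtain c where c: "a = c + pos_part u" "b = c + neg_part u" using shift_decomp[OF assms] .
  have "Poly_Mapping.single a 1 - Poly_Mapping.single b x = Poly_Mapping.single c 1 * binomP u x"
    unfolding c binomP_def by (simp only: right_diff_distrib mult_single mult_1)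
  then show ?thesis by blast
qed

section \<open>Solving the Euler equations for new family members\<close>

context open_dom
begin

lemma Eul_lam:
  assumes "Eul A \<beta> f"
  shows "(\<Sum>i\<in>UNIV. of_real (lamA A l i) * (z $ i * dd U i f z)) = lamC l \<beta> * f z"
proof -
  have "(\<Sum>i\<in>UNIV. of_real (lamA A l i) * (z $ i * dd U i f z))
      = (\<Sum>i\<in>UNIV. \<Sum>k\<in>UNIV. of_real (l $ k) * (of_int (A $ k $ i) * (z $ i * dd U i f z)))"
    by (simp add: lamA_def sum_distrib_right mult.assoc)
  also have "\<dots> = (\<Sum>k\<in>UNIV. of_real (l $ k) * (\<Sum>i\<in>UNIV. of_int (A $ k $ i) * (z $ i * dd U i f z)))"
    by (subst sum.swap) (simp add: sum_distrib_left)
  also have "\<dots> = (\<Sum>k\<in>UNIV. of_real (l $ k) * (\<beta> $ k * f z))"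
    using assms by (simp add: Eul_def)
  also have "\<dots> = lamC l \<beta> * f z" by (simp add: lamC_def sum_distrib_right mult.assoc)
  finally show ?thesis .
qed

text \<open>\<open>\<Phi> \<rho> w\<close> stands for \<open>\<partial>\<^sup>w f\<^sub>\<rho>\<close>, where \<open>w\<close> may have negative entries and the component \<open>f\<^sub>\<rho>\<close>
  itself is available only once \<open>0 \<in> V\<close>.\<close>

definition solution_family where
  "solution_family A \<beta> J f V \<Phi> \<longleftrightarrow>
     (\<forall>w\<in>V. (\<forall>j. w + axis j 1 \<in> V) \<and> (\<forall>u\<in>latL A. w + u \<in> V))
   \<and> (\<forall>\<rho>\<in>J. \<forall>w\<in>V. \<Phi> \<rho> w \<in> HU U \<and> Eul A (\<beta> - cdeg A w) (\<Phi> \<rho> w)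
        \<and> (\<forall>j. dd U j (\<Phi> \<rho> w) = \<Phi> \<rho> (w + axis j 1))
        \<and> (\<forall>u\<in>latL A. \<Phi> \<rho> (w + u) = (\<lambda>z. \<rho> u * \<Phi> \<rho> w z)))
   \<and> (\<forall>a. vecn a \<in> V \<longrightarrow> (\<forall>z. (\<Sum>\<rho>\<in>J. \<Phi> \<rho> (vecn a) z) = Dm a f z))"

text \<open>The Euler equations weighted by l contain no derivative in a direction of \<sigma>, and
  the factor of the function itself is nonzero by \<open>nz\<close>. Dividing by it defines a member
  at w from those at \<open>w + axis j 1\<close> with j outside \<sigma>.\<close>

lemma solution_family_extend:
  fixes A :: "((int, 'n) vec, 'k::finite) vec"
  assumes S: "solution_family A \<beta> J f V \<Phi>" and f: "f \<in> HU U" "Eul A \<beta> f"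
    and l: "\<And>j. j \<in> \<sigma> \<Longrightarrow> lamA A l j = 0" and nz: "\<And>w. lamC l (\<beta> - cdeg A w) \<noteq> 0"
  shows "\<exists>\<Psi>. solution_family A \<beta> J f {w. \<forall>j\<in>-\<sigma>. w + axis j 1 \<in> V} \<Psi>"
proof -
  define W where "W = {w. \<forall>j\<in>-\<sigma>. w + axis j 1 \<in> V}"
  define L where "L w = lamC l (\<beta> - cdeg A w)" for w
  define \<Psi> where "\<Psi> \<rho> w = (\<lambda>z. \<Sum>j\<in>-\<sigma>. (of_real (lamA A l j) / L w) * (z $ j * \<Phi> \<rho> (w + axis j 1) z))" for \<rho> w
  have up: "w + axis j 1 \<in> V" and upL: "u \<in> latL A \<Longrightarrow> w + u \<in> V" if "w \<in> V" for w j u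
    using S that by (auto simp: solution_family_def)
  have \<Phi>: "\<Phi> \<rho> w \<in> HU U" "Eul A (\<beta> - cdeg A w) (\<Phi> \<rho> w)" "dd U j (\<Phi> \<rho> w) = \<Phi> \<rho> (w + axis j 1)"
    "u \<in> latL A \<Longrightarrow> \<Phi> \<rho> (w + u) = (\<lambda>z. \<rho> u * \<Phi> \<rho> w z)" if "\<rho> \<in> J" "w \<in> V" for \<rho> w j u
    using S that unfolding solution_family_def by blast+
  have sumf: "(\<Sum>\<rho>\<in>J. \<Phi> \<rho> (vecn a) z) = Dm a f z" if "vecn a \<in> V" for a z
    using S that by (simp add: solution_family_def)
  have full: "(\<Sum>j\<in>-\<sigma>. of_real (lamA A l j) * (z $ j * dd U j g z)) = L w * g z"
    if "Eul A (\<beta> - cdeg A w) g" for g z w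
  proof -
    have "(\<Sum>j\<in>-\<sigma>. of_real (lamA A l j) * (z $ j * dd U j g z))
        = (\<Sum>j\<in>UNIV. of_real (lamA A l j) * (z $ j * dd U j g z))"
      by (rule sum.mono_neutral_left) (auto simp: l)
    then show ?thesis using Eul_lam[OF that] by (simp add: L_def)
  qed
  \<comment> \<open>On V the formula only restates the weighted Euler equation, so the new family
    extends the old one.\<close>
  have \<Psi>V: "\<Psi> \<rho> w = \<Phi> \<rho> w" if "\<rho> \<in> J" "w \<in> V" for \<rho> w
  proof
    fix z
    have "\<Psi> \<rho> w z = (\<Sum>j\<in>-\<sigma>. of_real (lamA A l j) * (z $ j * dd U j (\<Phi> \<rho> w) z)) / L w"
      using that by (simp add: \<Psi>_def \<Phi> sum_divide_distrib)
    then show "\<Psi> \<rho> w z = \<Phi> \<rho> w z"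
      using full[OF \<Phi>(2)[OF that]] nz[of w] by (simp add: L_def)
  qed
  have L_step: "L (w + axis i 1) = L w - of_real (lamA A l i)" for w i
    by (simp add: L_def cdeg_add lamC_diff lamC_cdeg_axis diff_diff_eq[symmetric])
  have "solution_family A \<beta> J f W \<Psi>"
    unfolding solution_family_def
  proof (intro conjI ballI allI impI)
    fix w i assume w: "w \<in> W"
    have "w + axis i 1 + axis j 1 \<in> V" if "j \<in> -\<sigma>" for j
    proof -
      have "w + axis i 1 + axis j 1 = w + axis j 1 + axis i 1" by (simp add: ac_simps)
      then show ?thesis using up[of "w + axis j 1" i] w that by (simp only: W_def mem_Collect_eq)
    qed
    then show "w + axis i 1 \<in> W" by (simp add: W_def)
  next
    fix w u assume w: "w \<in> W" and u: "u \<in> latL A"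
    have "w + u + axis j 1 \<in> V" if "j \<in> -\<sigma>" for j
    proof -
      have "w + u + axis j 1 = w + axis j 1 + u" by (simp add: ac_simps)
      then show ?thesis using upL[of "w + axis j 1" u] u w that by (simp only: W_def mem_Collect_eq)
    qed
    then show "w + u \<in> W" by (simp add: W_def)
  next
    fix \<rho> w assume \<rho>: "\<rho> \<in> J" and "w \<in> W"
    then have w: "w + axis j 1 \<in> V" if "j \<notin> \<sigma>" for j using that by (auto simp: W_def)
    show "\<Psi> \<rho> w \<in> HU U"
      unfolding \<Psi>_def using \<Phi>(1)[OF \<rho> w] by (intro HU_sum HU_coord) auto
    show "Eul A (\<beta> - cdeg A w) (\<Psi> \<rho> w)"
      unfolding \<Psi>_def
    proof (rule Eul_sum)
      fix j assume "j \<in> -\<sigma>"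
      then have j: "w + axis j 1 \<in> V" using w by auto
      show "(\<lambda>z. z $ j * \<Phi> \<rho> (w + axis j 1) z) \<in> HU U" by (intro HU_coord \<Phi>(1) \<rho> j)
      show "Eul A (\<beta> - cdeg A w) (\<lambda>z. z $ j * \<Phi> \<rho> (w + axis j 1) z)"
        using Eul_coord[OF \<Phi>(1)[OF \<rho> j] \<Phi>(2)[OF \<rho> j], of j] by (simp add: cdeg_add algebra_simps)
    qed
    show "dd U i (\<Psi> \<rho> w) = \<Psi> \<rho> (w + axis i 1)" for i
    proof
      fix z
      have "dd U i (\<Psi> \<rho> w) z = (\<Sum>j\<in>-\<sigma>. (of_real (lamA A l j) / L w) *
          (z $ j * \<Phi> \<rho> (w + axis i 1 + axis j 1) z + (if j = i then \<Phi> \<rho> (w + axis i 1) z else 0)))"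
        unfolding \<Psi>_def using \<Phi>(1)[OF \<rho> w] \<Phi>(3)[OF \<rho> w]
        by (subst dd_sum) (auto intro!: HU_coord sum.cong simp: dd_coord add.assoc add.commute[of "axis i 1"])
      also have "\<dots> = ((\<Sum>j\<in>-\<sigma>. of_real (lamA A l j) * (z $ j * \<Phi> \<rho> (w + axis i 1 + axis j 1) z))
          + of_real (lamA A l i) * \<Phi> \<rho> (w + axis i 1) z) / L w"
        by (simp add: distrib_left sum.distrib if_distrib[of "\<lambda>x. _ * x"] sum_divide_distrib
            add_divide_distrib l cong: if_cong)
      also have "\<dots> = \<Psi> \<rho> (w + axis i 1) z"
      \<comment> \<open>For i in \<sigma> the form kills the i-th column: the product rule term
        vanishes and L is equal at w and \<open>w + axis i 1\<close>. For other i the point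
        \<open>w + axis i 1\<close> lies in V, where the Euler equation turns the sum into L times
        the member; there L is smaller than \<open>L w\<close> by exactly the coefficient of the
        product rule term.\<close>
      proof (cases "i \<in> \<sigma>")
        case True
        then show ?thesis using L_step[of w i] by (simp add: l \<Psi>_def sum_divide_distrib)
      next
        case False
        have "(\<Sum>j\<in>-\<sigma>. of_real (lamA A l j) * (z $ j * \<Phi> \<rho> (w + axis i 1 + axis j 1) z))
            = L (w + axis i 1) * \<Phi> \<rho> (w + axis i 1) z"
          using full[OF \<Phi>(2)[OF \<rho> w[OF False]], of z] by (simp add: \<Phi>(3)[OF \<rho> w[OF False]])
        then show ?thesis
          using nz[of w] unfolding \<Psi>V[OF \<rho> w[OF False]] by (simp add: L_step L_def[symmetric] algebra_simps)
      qed
      finally show "dd U i (\<Psi> \<rho> w) z = \<Psi> \<rho> (w + axis i 1) z" .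
    qed
    fix u assume u: "u \<in> latL A"
    have "L (w + u) = L w" by (simp add: L_def cdeg_add cdeg_latL[OF u])
    moreover have "\<Phi> \<rho> (w + u + axis j 1) = (\<lambda>z. \<rho> u * \<Phi> \<rho> (w + axis j 1) z)" if "j \<notin> \<sigma>" for j
      using \<Phi>(4)[OF \<rho> w[OF that] u] by (simp add: add.assoc add.commute[of u])
    ultimately show "\<Psi> \<rho> (w + u) = (\<lambda>z. \<rho> u * \<Psi> \<rho> w z)"
      by (auto simp: \<Psi>_def fun_eq_iff sum_distrib_left mult_ac intro!: sum.cong)
  next
    fix a z assume "vecn a \<in> W"
    then have w: "vecn (a + unit j) \<in> V" if "j \<notin> \<sigma>" for j
      using that by (auto simp: W_def vecn_add vecn_unit)
    \<comment> \<open>After exchanging the sums, the inner ones are derivatives of f because V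
      already has the sum property; the weighted Euler equation for \<open>Dm a f\<close> then gives
      back \<open>Dm a f\<close>.\<close>
    have "(\<Sum>\<rho>\<in>J. \<Psi> \<rho> (vecn a) z) = (\<Sum>j\<in>-\<sigma>. (of_real (lamA A l j) / L (vecn a)) *
        (z $ j * (\<Sum>\<rho>\<in>J. \<Phi> \<rho> (vecn (a + unit j)) z)))"
      unfolding \<Psi>_def by (subst sum.swap) (simp add: sum_distrib_left vecn_add vecn_unit)
    also have "\<dots> = (\<Sum>j\<in>-\<sigma>. (of_real (lamA A l j) / L (vecn a)) * (z $ j * dd U j (Dm a f) z))"
      using sumf[OF w] f(1) by (intro sum.cong) (simp_all add: Dm_step)
    also have "\<dots> = (\<Sum>j\<in>-\<sigma>. of_real (lamA A l j) * (z $ j * dd U j (Dm a f) z)) / L (vecn a)"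
      by (simp add: sum_divide_distrib)
    also have "\<dots> = Dm a f z"
      using full[OF Eul_Dm[OF f]] nz[of "vecn a"] by (simp add: L_def)
    finally show "(\<Sum>\<rho>\<in>J. \<Psi> \<rho> (vecn a) z) = Dm a f z" .
  qed
  then show ?thesis unfolding W_def by blast
qed

text \<open>One \<sigma> is treated at a time. Index sets are closed under adding unit vectors, so
  each extension contains the previous index set and nothing gained earlier is lost.\<close>

lemma solution_family_extend_all:
  fixes A :: "((int, 'n) vec, 'k::finite) vec"
  assumes "finite \<S>" and S: "solution_family A \<beta> J f V \<Phi>" and f: "f \<in> HU U" "Eul A \<beta> f"
    and l: "\<And>\<sigma>. \<sigma> \<in> \<S> \<Longrightarrow> \<exists>l. (\<forall>j\<in>\<sigma>. lamA A l j = 0) \<and> (\<forall>w. lamC l (\<beta> - cdeg A w) \<noteq> 0)"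
  shows "\<exists>V' \<Psi>. solution_family A \<beta> J f V' \<Psi> \<and> V \<subseteq> V' \<and> (\<forall>\<sigma>\<in>\<S>. {w. \<forall>j\<in>-\<sigma>. w + axis j 1 \<in> V} \<subseteq> V')"
  using assms(1) l
proof (induction \<S>)
  case empty
  then show ?case using S by auto
next
  case (insert \<sigma> \<S>)
  have "\<exists>V' \<Psi>. solution_family A \<beta> J f V' \<Psi> \<and> V \<subseteq> V' \<and> (\<forall>\<sigma>\<in>\<S>. {w. \<forall>j\<in>-\<sigma>. w + axis j 1 \<in> V} \<subseteq> V')"
    by (rule insert.IH) (use insert.prems in simp)
  then obtain V' \<Psi> where V': "solution_family A \<beta> J f V' \<Psi>" "V \<subseteq> V'"
      "\<forall>\<sigma>\<in>\<S>. {w. \<forall>j\<in>-\<sigma>. w + axis j 1 \<in> V} \<subseteq> V'"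
    by (elim exE conjE)
  define V'' where "V'' = {w. \<forall>j\<in>-\<sigma>. w + axis j 1 \<in> V'}"
  obtain l where "\<forall>j\<in>\<sigma>. lamA A l j = 0" "\<forall>w. lamC l (\<beta> - cdeg A w) \<noteq> 0"
    using insert.prems[OF insertI1] by (elim exE conjE)
  then have "\<exists>\<Psi>. solution_family A \<beta> J f V'' \<Psi>"
    unfolding V''_def by (intro solution_family_extend[OF V'(1) f, of \<sigma> l]) simp_all
  then obtain \<Psi>' where "solution_family A \<beta> J f V'' \<Psi>'" ..
  moreover have "V' \<subseteq> V''" using V'(1) by (auto simp: V''_def solution_family_def)
  moreover have "{w. \<forall>j\<in>-\<sigma>. w + axis j 1 \<in> V} \<subseteq> V''" using V'(2) by (auto simp: V''_def)
  moreover have "V \<subseteq> V''" using V'(2) calculation(2) by blast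
  moreover have "\<forall>\<tau>\<in>insert \<sigma> \<S>. {w. \<forall>j\<in>-\<tau>. w + axis j 1 \<in> V} \<subseteq> V''"
    unfolding ball_simps(7) using V'(3) calculation(2,3) by (intro conjI ballI) (auto intro: subset_trans)
  ultimately show ?case by (intro exI[of _ V''] exI[of _ \<Psi>'] conjI)
qed

lemma solution_family_reaches_zero:
  fixes A :: "((int, 'n) vec, 'k::finite) vec"
  assumes S: "solution_family A \<beta> J f V \<Phi>" and f: "f \<in> HU U" "Eul A \<beta> f"
    and l: "\<And>\<sigma>. \<not> spanning A \<sigma> \<Longrightarrow> \<exists>l. (\<forall>j\<in>\<sigma>. lamA A l j = 0) \<and> (\<forall>w. lamC l (\<beta> - cdeg A w) \<noteq> 0)"
    and N: "\<And>a. spanning A {j. N \<le> a j} \<Longrightarrow> vecn a \<in> V" and A: "spanning A UNIV"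
  shows "\<exists>V' \<Psi>. solution_family A \<beta> J f V' \<Psi> \<and> 0 \<in> V'"
proof -
  \<comment> \<open>Induction on the total amount by which the entries of \<open>a\<close> fall short of \<open>N\<close>: extending along
    \<open>\<sigma> = {j. N \<le> a j}\<close> only needs family members with a smaller shortfall.\<close>
  have "\<exists>V' \<Psi>. solution_family A \<beta> J f V' \<Psi> \<and> V \<subseteq> V' \<and> (\<forall>a. (\<Sum>j\<in>UNIV. N - a j) \<le> d \<longrightarrow> vecn a \<in> V')" for d
  proof (induction d)
    case 0
    have "vecn a \<in> V" if "(\<Sum>j\<in>UNIV. N - a j) \<le> 0" for a
    proof -
      have "{j. N \<le> a j} = UNIV" using that by auto
      then show ?thesis using N A by simp
    qed
    then show ?case using S by blast
  next
    case (Suc d)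
    then obtain V' \<Psi> where V': "solution_family A \<beta> J f V' \<Psi>" "V \<subseteq> V'"
        "\<And>a. (\<Sum>j\<in>UNIV. N - a j) \<le> d \<Longrightarrow> vecn a \<in> V'"
      by blast
    have "finite {\<sigma>. \<not> spanning A \<sigma>}" by (rule finite_subset[of _ "Pow UNIV"]) auto
    then have "\<exists>V'' \<Psi>. solution_family A \<beta> J f V'' \<Psi> \<and> V' \<subseteq> V''
        \<and> (\<forall>\<sigma>\<in>{\<sigma>. \<not> spanning A \<sigma>}. {w. \<forall>j\<in>-\<sigma>. w + axis j 1 \<in> V'} \<subseteq> V'')"
      by (rule solution_family_extend_all[OF _ V'(1) f]) (use l in simp)
    then obtain V'' \<Psi>' where V'': "solution_family A \<beta> J f V'' \<Psi>'" "V' \<subseteq> V''"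
        "\<And>\<sigma>. \<not> spanning A \<sigma> \<Longrightarrow> {w. \<forall>j\<in>-\<sigma>. w + axis j 1 \<in> V'} \<subseteq> V''"
      by auto
    have "vecn a \<in> V''" if a: "(\<Sum>j\<in>UNIV. N - a j) \<le> Suc d" for a
    proof (cases "spanning A {j. N \<le> a j}")
      case True
      then show ?thesis using N V'(2) V''(2) by blast
    next
      case False
      have "vecn a + axis i 1 \<in> V'" if i: "\<not> N \<le> a i" for i
      proof -
        have "(\<Sum>j\<in>UNIV. N - (a + unit i) j) < (\<Sum>j\<in>UNIV. N - a j)"
          by (rule sum_strict_mono_ex1) (use i in \<open>auto simp: unit_def intro!: bexI[of _ i]\<close>)
        then have "vecn (a + unit i) \<in> V'" using a by (intro V'(3)) simp
        then show ?thesis by (simp only: vecn_add vecn_unit)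
      qed
      then show ?thesis using V''(3)[OF False] by auto
    qed
    then show ?case using V'' V'(2) by blast
  qed
  \<comment> \<open>Taking d as N times the number of variables covers the exponent 0, where every
    entry falls short by N.\<close>
  from this[of "\<Sum>j\<in>(UNIV::'n set). N"] obtain V' \<Psi> where "solution_family A \<beta> J f V' \<Psi>"
      and V': "\<And>a::'n \<Rightarrow> nat. (\<Sum>j\<in>UNIV. N - a j) \<le> (\<Sum>j\<in>(UNIV::'n set). N) \<Longrightarrow> vecn a \<in> V'"
    by blast
  moreover have "vecn 0 \<in> V'" by (rule V') (intro sum_mono, simp)
  then have "0 \<in> V'" by (simp only: vecn_zero)
  ultimately show ?thesis by (intro exI[of _ V'] exI[of _ \<Psi>] conjI)
qed

section \<open>The starting family from the separating operators\<close>

lemma binom_shift: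
  assumes f: "f \<in> HU U" and k: "opP (binomP u c) f = (\<lambda>z. 0)" and ab: "vecn a = vecn b + u"
  shows "Dm a f = (\<lambda>z. c * Dm b f z)"
proof -
  obtain Q where Q: "Poly_Mapping.single a 1 - Poly_Mapping.single b c = Q * binomP u c"
    using single_diff_single[OF ab] by blast
  have "opP (Poly_Mapping.single a 1 - Poly_Mapping.single b c) f = opP Q (\<lambda>z. 0)"
    unfolding Q opP_mult[OF f] k ..
  also have "\<dots> = (\<lambda>z. 0)" using opP_cmult[OF HU_zero, of Q 0] by simp
  finally show ?thesis by (simp add: opP_diff opP_single fun_eq_iff)
qed

lemma binom_shift_conv:
  assumes "Dm (pos_part u) f = (\<lambda>z. c * Dm (neg_part u) f z)"
  shows "opP (binomP u c) f = (\<lambda>z. 0)"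
  unfolding binomP_def opP_diff opP_single assms by simp

text \<open>Let \<phi>_\<rho> = P_\<rho> f with separating operators P_\<rho>. An index w = \<alpha>
  + a + u with u in L receives \<rho>(u) \<partial>^a \<phi>_\<rho>, as P_\<rho> should act on the
  component f_\<rho> as \<partial>^\<alpha>.\<close>

lemma solution_family_base:
  fixes A :: "((int, 'n) vec, 'k::finite) vec" and B :: "((int, 'm::finite) vec, 'n) vec"
  assumes J: "finite J" "J \<subseteq> charG A B" and f: "f \<in> HU U" "Eul A \<beta> f"
    and kill: "\<And>P. (\<And>\<rho>. \<rho> \<in> J \<Longrightarrow> lookup P \<in> I_rho A \<rho>) \<Longrightarrow> opP P f = (\<lambda>z. 0)"
  shows "\<exists>\<alpha> \<Phi>. solution_family A \<beta> J f {w. \<exists>a. w - vecn \<alpha> - vecn a \<in> latL A} \<Phi>"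
proof -
  obtain \<alpha> P where *: "\<forall>\<rho>\<in>J. (\<forall>\<rho>'\<in>J - {\<rho>}. lookup (P \<rho>) \<in> I_rho A \<rho>') \<and> homog A \<alpha> (P \<rho>)
      \<and> lookup (P \<rho> - Poly_Mapping.single \<alpha> 1) \<in> I_rho A \<rho>"
    using exists_separating_family[OF J] by (elim exE)
  have P1: "lookup (P \<rho>) \<in> I_rho A \<rho>'" if "\<rho> \<in> J" "\<rho>' \<in> J" "\<rho>' \<noteq> \<rho>" for \<rho> \<rho>'
    using *[rule_format, OF that(1)] that by blast
  have P2: "homog A \<alpha> (P \<rho>)" if "\<rho> \<in> J" for \<rho>
    using *[rule_format, OF that] by blast
  have P3: "lookup (P \<rho> - Poly_Mapping.single \<alpha> 1) \<in> I_rho A \<rho>" if "\<rho> \<in> J" for \<rho>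
    using *[rule_format, OF that] by blast
  define V where "V = {w. \<exists>a. w - vecn \<alpha> - vecn a \<in> latL A}"
  define \<phi> where "\<phi> \<rho> = opP (P \<rho>) f" for \<rho>
  have \<phi>: "\<phi> \<rho> \<in> HU U" for \<rho> unfolding \<phi>_def by (rule HU_opP[OF f(1)])
  have E\<phi>: "Eul A (\<beta> - cdeg A (vecn \<alpha>)) (\<phi> \<rho>)" if "\<rho> \<in> J" for \<rho>
    unfolding \<phi>_def by (rule Eul_opP[OF f P2[OF that]])
  \<comment> \<open>A generator of I_\<rho> times P_\<rho> lies in the ideal of every character in
    J: the first factor takes care of \<rho>, the second of all others.\<close>
  have k\<phi>: "opP (binomP u (\<rho> u)) (\<phi> \<rho>) = (\<lambda>z. 0)" if \<rho>: "\<rho> \<in> J" and u: "u \<in> latL A" for \<rho> u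
  proof -
    have "opP (binomP u (\<rho> u) * P \<rho>) f = (\<lambda>z. 0)"
    proof (rule kill)
      fix \<rho>' assume "\<rho>' \<in> J"
      show "lookup (binomP u (\<rho> u) * P \<rho>) \<in> I_rho A \<rho>'"
      proof (cases "\<rho>' = \<rho>")
        case True
        then show ?thesis using binomP_I_rho[OF u, of \<rho>]
          unfolding I_rho_def mult.commute[of _ "P \<rho>"] by (simp add: lookup_mult_dideal)
      next
        case False
        then show ?thesis using P1[OF \<rho> \<open>\<rho>' \<in> J\<close>]
          unfolding I_rho_def by (simp add: lookup_mult_dideal)
      qed
    qed
    then show ?thesis by (simp add: \<phi>_def opP_mult f)
  qed
  define sel where "sel w = (SOME a. w - vecn \<alpha> - vecn a \<in> latL A)" for w
  define \<Phi> where "\<Phi> \<rho> w = (\<lambda>z. \<rho> (w - vecn \<alpha> - vecn (sel w)) * Dm (sel w) (\<phi> \<rho>) z)" for \<rho> w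
  \<comment> \<open>Independence of the chosen exponent: two choices differ by an element of L, and
    the binomial relation of \<phi> for it compensates the change of the character factor.\<close>
  have \<Phi>: "\<Phi> \<rho> w = (\<lambda>z. \<rho> (w - vecn \<alpha> - vecn a) * Dm a (\<phi> \<rho>) z)"
    if \<rho>: "\<rho> \<in> J" and a: "w - vecn \<alpha> - vecn a \<in> latL A" for \<rho> w a
  proof -
    have s: "w - vecn \<alpha> - vecn (sel w) \<in> latL A"
      unfolding sel_def by (rule someI[of "\<lambda>a. w - vecn \<alpha> - vecn a \<in> latL A", OF a])
    define u where "u = vecn (sel w) - vecn a"
    have "u = (w - vecn \<alpha> - vecn a) - (w - vecn \<alpha> - vecn (sel w))" by (simp add: u_def)
    then have u: "u \<in> latL A" using latL_diff[OF a s] by simp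
    have "Dm (sel w) (\<phi> \<rho>) = (\<lambda>z. \<rho> u * Dm a (\<phi> \<rho>) z)"
      by (rule binom_shift[OF \<phi> k\<phi>[OF \<rho> u]]) (simp add: u_def)
    moreover have "\<rho> (w - vecn \<alpha> - vecn a) = \<rho> (w - vecn \<alpha> - vecn (sel w)) * \<rho> u"
    proof -
      have "w - vecn \<alpha> - vecn a = (w - vecn \<alpha> - vecn (sel w)) + u" by (simp add: u_def)
      then show ?thesis using char_add[of \<rho> A B, OF _ s u] \<rho> J(2) by (metis subsetD)
    qed
    ultimately show ?thesis by (simp add: \<Phi>_def mult.assoc)
  qed
  have "solution_family A \<beta> J f V \<Phi>"
    unfolding solution_family_def
  proof (intro conjI ballI allI impI)
    fix w j assume "w \<in> V"
    then obtain a where "w - vecn \<alpha> - vecn a \<in> latL A" by (auto simp: V_def)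
    then have "w + axis j 1 - vecn \<alpha> - vecn (a + unit j) \<in> latL A" by (simp add: vecn_add vecn_unit algebra_simps)
    then show "w + axis j 1 \<in> V" unfolding V_def by blast
  next
    fix w u assume "w \<in> V" and u: "u \<in> latL A"
    then obtain a where "w - vecn \<alpha> - vecn a \<in> latL A" by (auto simp: V_def)
    then have "w - vecn \<alpha> - vecn a + u \<in> latL A" by (rule latL_add[OF _ u])
    then have "w + u - vecn \<alpha> - vecn a \<in> latL A" by (simp add: algebra_simps)
    then show "w + u \<in> V" unfolding V_def by blast
  next
    fix \<rho> w assume \<rho>: "\<rho> \<in> J" and "w \<in> V"
    then obtain a where a: "w - vecn \<alpha> - vecn a \<in> latL A" by (auto simp: V_def)
    note \<Phi>a = \<Phi>[OF \<rho> a]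
    show "\<Phi> \<rho> w \<in> HU U" unfolding \<Phi>a by (intro HU_cmult HU_Dm \<phi>)
    have "cdeg A w = cdeg A (vecn \<alpha> + vecn a)"
      by (rule cdeg_cong_latL) (use a in \<open>simp add: diff_diff_eq\<close>)
    then have "Eul A (\<beta> - cdeg A w) (Dm a (\<phi> \<rho>))"
      using Eul_Dm[OF \<phi> E\<phi>[OF \<rho>], of a] by (simp add: cdeg_add diff_diff_eq)
    then show "Eul A (\<beta> - cdeg A w) (\<Phi> \<rho> w)"
      unfolding \<Phi>a using Eul_sum[of "{()}" "\<lambda>_. Dm a (\<phi> \<rho>)" A "\<beta> - cdeg A w" "\<lambda>_. \<rho> (w - vecn \<alpha> - vecn a)"]
      by (simp add: HU_Dm \<phi>)
    show "dd U j (\<Phi> \<rho> w) = \<Phi> \<rho> (w + axis j 1)" for j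
    proof -
      have e: "w + axis j 1 - vecn \<alpha> - vecn (a + unit j) = w - vecn \<alpha> - vecn a"
        by (simp add: vecn_add vecn_unit)
      have "\<Phi> \<rho> (w + axis j 1) = (\<lambda>z. \<rho> (w - vecn \<alpha> - vecn a) * Dm (a + unit j) (\<phi> \<rho>) z)"
        using \<Phi>[OF \<rho>, of "w + axis j 1" "a + unit j"] a unfolding e by simp
      then show ?thesis unfolding \<Phi>a by (simp only: dd_cmult HU_Dm \<phi> Dm_step)
    qed
    fix u assume u: "u \<in> latL A"
    have e: "w + u - vecn \<alpha> - vecn a = u + (w - vecn \<alpha> - vecn a)" by simp
    have "\<Phi> \<rho> (w + u) = (\<lambda>z. \<rho> (u + (w - vecn \<alpha> - vecn a)) * Dm a (\<phi> \<rho>) z)"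
      using \<Phi>[OF \<rho>, of "w + u" a] latL_add[OF u a] unfolding e by simp
    moreover have "\<rho> (u + (w - vecn \<alpha> - vecn a)) = \<rho> u * \<rho> (w - vecn \<alpha> - vecn a)"
      using char_add[of \<rho> A B, OF _ u a] \<rho> J by blast
    ultimately show "\<Phi> \<rho> (w + u) = (\<lambda>z. \<rho> u * \<Phi> \<rho> w z)"
      unfolding \<Phi>a by (simp add: mult.assoc)
  next
    fix b z assume "vecn b \<in> V"
    then obtain a where a: "vecn b - vecn \<alpha> - vecn a \<in> latL A" by (auto simp: V_def)
    define u where "u = vecn b - vecn \<alpha> - vecn a"
    have b: "vecn b = vecn (a + \<alpha>) + u" by (simp add: u_def vecn_add)
    define T where "T \<rho> = Poly_Mapping.single a (\<rho> u) * P \<rho>" for \<rho>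
    \<comment> \<open>R lies in I_\<rho> for all \<rho> in J: modulo I_\<rho> the terms of the other
      characters vanish, and \<open>T \<rho>\<close> is congruent to \<rho>(u) \<partial>^(a +
      \<alpha>), hence to \<partial>^b because b = a + \<alpha> + u.\<close>
    define R where "R = Poly_Mapping.single b 1 - (\<Sum>\<rho>\<in>J. T \<rho>)"
    have "opP R f = (\<lambda>z. 0)"
    proof (rule kill)
      fix \<rho> assume \<rho>: "\<rho> \<in> J"
      obtain Q where Q: "Poly_Mapping.single b 1 - Poly_Mapping.single (a + \<alpha>) (\<rho> u) = Q * binomP u (\<rho> u)"
        using single_diff_single[OF b] by blast
      have "R = Q * binomP u (\<rho> u) - Poly_Mapping.single a (\<rho> u) * (P \<rho> - Poly_Mapping.single \<alpha> 1)
          - (\<Sum>\<rho>'\<in>J - {\<rho>}. T \<rho>')"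
        unfolding Q[symmetric] R_def sum.remove[OF J(1) \<rho>] by (simp add: T_def right_diff_distrib mult_single)
      moreover have "lookup (\<Sum>\<rho>'\<in>J - {\<rho>}. T \<rho>') \<in> I_rho A \<rho>"
        unfolding I_rho_def T_def using P1[OF _ \<rho>]
        by (intro lookup_sum_dideal lookup_mult_dideal) (auto simp: I_rho_def)
      ultimately show "lookup R \<in> I_rho A \<rho>"
        using P3[OF \<rho>] binomP_I_rho[of u A \<rho>] a
        by (simp add: I_rho_def lookup_mult_dideal lookup_diff_dideal u_def)
    qed
    then have "Dm b f z = (\<Sum>\<rho>\<in>J. opP (T \<rho>) f z)"
      by (simp add: R_def opP_diff opP_single opP_sum fun_eq_iff)
    also have "\<dots> = (\<Sum>\<rho>\<in>J. \<Phi> \<rho> (vecn b) z)"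
      using \<Phi>[OF _ a] by (intro sum.cong refl) (simp add: T_def opP_mult f opP_single \<phi>_def u_def)
    finally show "(\<Sum>\<rho>\<in>J. \<Phi> \<rho> (vecn b) z) = Dm b f z" by simp
  qed
  then show ?thesis unfolding V_def by blast
qed

end

section \<open>Lattices and characters\<close>

definition rvec :: "(int, 'n::finite) vec \<Rightarrow> (real, 'n) vec" where
  "rvec u = (\<chi> i. of_int (u $ i))"

lemma rvec_nth [simp]: "rvec u $ i = of_int (u $ i)"
  by (simp add: rvec_def)

lemma rvec_add: "rvec (u + v) = rvec u + rvec v"
  by (simp add: vec_eq_iff)

lemma rvec_inj: "rvec u = rvec v \<longleftrightarrow> u = v"
  by (simp add: vec_eq_iff)

lemma real_mat_rvec: "real_mat M *v rvec u = rvec (M *v u)"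
  by (simp add: vec_eq_iff real_mat_def matrix_vector_mult_def)

text \<open>The range of N lies in the kernel of M, and by the rank condition its dimension is at
  least that of the kernel.\<close>

lemma ker_eq_range:
  fixes M :: "((real, 'n::finite) vec, 'k::finite) vec" and N :: "((real, 'm::finite) vec, 'n) vec"
  assumes card: "CARD('n) \<le> rank M + rank N" and 0: "\<And>s. M *v (N *v s) = 0"
  shows "{x. M *v x = 0} = range ((*v) N)"
proof -
  have sub: "subspace {x. M *v x = 0}"
    by (rule subspaceI) (simp_all add: matrix_vector_right_distrib matrix_vector_mult_scaleR)
  \<comment> \<open>The kernel is the orthogonal complement of the row space, which determines its
    dimension.\<close>
  have orth: "{x. M *v x = 0} = {y \<in> UNIV. \<forall>x\<in>span (rows M). orthogonal x y}"
  proof safe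
    fix x y assume "M *v y = 0" "x \<in> span (rows M)"
    then show "orthogonal x y" using orthogonal_nullspace_rowspace orthogonal_commute by blast
  next
    fix y assume *: "\<forall>x\<in>span (rows M). orthogonal x y"
    have "(M *v y) $ k = 0" for k
    proof -
      have "row k M \<in> span (rows M)" by (rule span_base) (auto simp: rows_def)
      then have "row k M \<bullet> y = 0" using * by (simp add: orthogonal_def)
      then show ?thesis by (simp add: matrix_vector_mul_component row_def)
    qed
    then show "M *v y = 0" by (simp add: vec_eq_iff)
  qed simp
  have "dim {x. M *v x = 0} + dim (span (rows M)) = dim (UNIV :: (real, 'n) vec set)"
    unfolding orth by (rule dim_subspace_orthogonal_to_vectors) auto
  then have "dim {x. M *v x = 0} + rank M = CARD('n)"
    by (simp add: row_rank_def)
  then have "dim {x. M *v x = 0} \<le> dim (range ((*v) N))"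
    using card by (simp add: rank_dim_range[symmetric])
  moreover have "subspace (range ((*v) N))"
    by (intro linear_subspace_image subspace_UNIV matrix_vector_mul_linear)
  moreover have "range ((*v) N) \<subseteq> {x. M *v x = 0}" using 0 by auto
  ultimately show ?thesis using subspace_dim_equal[OF _ sub] by metis
qed

text \<open>A crude bound, the same for all rows, for the change of B s when every coordinate of s
  moves by at most 1.\<close>

definition Bbound :: "((int, 'm::finite) vec, 'n::finite) vec \<Rightarrow> real" where
  "Bbound B = (\<Sum>i\<in>UNIV. \<Sum>l\<in>UNIV. \<bar>of_int (B $ i $ l)\<bar>)"

lemma rounding:
  fixes B :: "((int, 'm::finite) vec, 'n::finite) vec"
  shows "\<exists>v. \<forall>i. \<bar>(real_mat B *v s) $ i - of_int ((B *v v) $ i)\<bar> \<le> Bbound B"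
proof (intro exI allI)
  fix i
  have "(real_mat B *v s) $ i - of_int ((B *v (\<chi> l. \<lfloor>s $ l\<rfloor>)) $ i)
      = (\<Sum>l\<in>UNIV. of_int (B $ i $ l) * (s $ l - of_int \<lfloor>s $ l\<rfloor>))"
    by (simp add: matrix_vector_mult_def real_mat_def right_diff_distrib sum_subtractf)
  also have "\<bar>\<dots>\<bar> \<le> (\<Sum>l\<in>UNIV. \<bar>of_int (B $ i $ l) * (s $ l - of_int \<lfloor>s $ l\<rfloor>)\<bar>)"
    by (rule sum_abs)
  also have "\<dots> \<le> (\<Sum>l\<in>UNIV. \<bar>of_int (B $ i $ l)\<bar>)"
  proof (rule sum_mono)
    fix l
    have "\<bar>s $ l - of_int \<lfloor>s $ l\<rfloor>\<bar> \<le> 1" by linarith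
    then show "\<bar>of_int (B $ i $ l) * (s $ l - of_int \<lfloor>s $ l\<rfloor>)\<bar> \<le> \<bar>of_int (B $ i $ l) :: real\<bar>"
      by (simp add: abs_mult mult_left_le)
  qed
  also have "\<dots> \<le> Bbound B"
    unfolding Bbound_def by (rule member_le_sum) (auto intro: sum_nonneg)
  finally show "\<bar>(real_mat B *v s) $ i - of_int ((B *v (\<chi> l. \<lfloor>s $ l\<rfloor>)) $ i)\<bar> \<le> Bbound B" .
qed

text \<open>Columns outside \<sigma> are replaced by zero. Spanning makes the transpose of the new
  matrix injective, hence the matrix itself surjective.\<close>

lemma spanning_solve:
  fixes A :: "((int, 'n::finite) vec, 'k::finite) vec"
  assumes "spanning A \<sigma>"
  shows "\<exists>t. (\<forall>j. j \<notin> \<sigma> \<longrightarrow> t $ j = 0) \<and> real_mat A *v t = y"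
proof -
  define M :: "((real, 'n) vec, 'k) vec" where "M = (\<chi> k j. if j \<in> \<sigma> then of_int (A $ k $ j) else 0)"
  have "(transpose M *v l) $ j = (if j \<in> \<sigma> then lamA A l j else 0)" for l j
    by (simp add: M_def matrix_vector_mult_def transpose_def lamA_def mult.commute)
  then have "l = 0" if "transpose M *v l = 0" for l
    using that assms by (simp add: spanning_def vec_eq_iff) (metis zero_index)
  then have "inj ((*v) (transpose M))"
    by (metis matrix_left_invertible_ker matrix_left_invertible_injective)
  then have "rank M = CARD('k)" by (metis full_rank_injective rank_transpose)
  then have "surj ((*v) M)" by (simp add: full_rank_surjective)
  then obtain t where t: "M *v t = y" by (metis surjD)
  define t' where "t' = (\<chi> j. if j \<in> \<sigma> then t $ j else 0)"
  have "real_mat A *v t' = M *v t"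
    by (auto simp: t'_def M_def real_mat_def matrix_vector_mult_def vec_eq_iff intro!: sum.cong)
  then show ?thesis using t by (intro exI[of _ t']) (simp add: t'_def)
qed

section \<open>The lattices L and L_B, rounding and coset representatives\<close>

locale lattice_pair =
  fixes A :: "((int, 'n::finite) vec, 'k::finite) vec" and B :: "((int, 'm::finite) vec, 'n) vec"
  assumes card_less: "CARD('m) < CARD('n)" and card_k: "CARD('k) = CARD('n) - CARD('m)"
    and rank_B: "rank (real_mat B) = CARD('m)" and rank_A: "rank (real_mat A) = CARD('k)"
    and AB: "A ** B = 0"
begin

lemma latB_subset_latL: "latB B \<subseteq> latL A"
  by (auto simp: latB_def latL_def matrix_vector_mul_assoc AB)

lemma latB_add: "u \<in> latB B \<Longrightarrow> v \<in> latB B \<Longrightarrow> u + v \<in> latB B"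
  unfolding latB_def by (auto simp: matrix_vector_right_distrib[symmetric])

lemma latB_diff: "u \<in> latB B \<Longrightarrow> v \<in> latB B \<Longrightarrow> u - v \<in> latB B"
  unfolding latB_def by (auto simp: matrix_vector_mult_diff_distrib[symmetric])

lemma latB_zero: "0 \<in> latB B"
  unfolding latB_def using matrix_vector_mult_0_right[of B] by (metis rangeI)

lemma ker_real: "{x. real_mat A *v x = 0} = range ((*v) (real_mat B))"
proof (rule ker_eq_range)
  show "CARD('n) \<le> rank (real_mat A) + rank (real_mat B)"
    using card_less card_k rank_A rank_B by simp
  have "real_mat A ** real_mat B = (\<chi> i j. of_int ((A ** B) $ i $ j))"
    by (simp add: vec_eq_iff matrix_matrix_mult_def real_mat_def)
  then have "real_mat A ** real_mat B = 0" by (simp add: AB vec_eq_iff)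
  then show "real_mat A *v (real_mat B *v s) = 0" for s
    by (simp add: matrix_vector_mul_assoc)
qed

lemma inj_real_B: "real_mat B *v s = real_mat B *v t \<longleftrightarrow> s = t"
  using rank_B full_rank_injective[of "real_mat B"] by (auto dest: injD)

lemma spanning_UNIV: "spanning A UNIV"
  unfolding spanning_def
proof (intro allI impI)
  fix l assume *: "\<forall>j\<in>UNIV. lamA A l j = 0"
  have "transpose (real_mat A) *v l = 0"
    using * by (simp add: vec_eq_iff real_mat_def matrix_vector_mult_def transpose_def lamA_def mult.commute)
  moreover have "inj ((*v) (transpose (real_mat A)))"
    using rank_A full_rank_injective[of "transpose (real_mat A)"] by (simp add: rank_transpose)
  ultimately show "l = 0" by (metis injD matrix_vector_mult_0_right)
qed

text \<open>Elements of L have real coordinates with respect to B; rounding these leaves a remainder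
  in a fixed box, which is why L/L_B is finite.\<close>

lemma latL_rounding:
  assumes "u \<in> latL A"
  shows "\<exists>v\<in>latB B. \<forall>i. \<bar>(u - v) $ i\<bar> \<le> \<lfloor>Bbound B\<rfloor>"
proof -
  have "real_mat A *v rvec u = 0"
    using assms by (simp add: real_mat_rvec latL_def vec_eq_iff)
  then obtain s where s: "rvec u = real_mat B *v s" using ker_real by blast
  obtain v where "\<forall>i. \<bar>(real_mat B *v s) $ i - of_int ((B *v v) $ i)\<bar> \<le> Bbound B"
    using rounding by blast
  then have "\<forall>i. \<bar>(u - B *v v) $ i\<bar> \<le> \<lfloor>Bbound B\<rfloor>"
    unfolding s[symmetric] by (simp add: le_floor_iff)
  then show ?thesis unfolding latB_def by blast
qed

text \<open>Solve A t = A w in reals with t supported on \<sigma>. Then w - t = B s, and rounding s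
  yields an integer vector B v with a - \<alpha> + B v \<ge> a - t \<ge> 0 as soon as a is large on
  \<sigma>.\<close>

lemma large_imp_shifted:
  assumes "spanning A \<sigma>"
  shows "\<exists>N. \<forall>a. (\<forall>j\<in>\<sigma>. N \<le> a j) \<longrightarrow> (\<exists>b. vecn a - vecn \<alpha> - vecn b \<in> latL A)"
proof -
  \<comment> \<open>The summand \<open>Bbound B\<close> absorbs the rounding error, so that \<alpha>
    - t \<le> B v holds in every entry.\<close>
  define w where "w = (\<chi> j. real (\<alpha> j) + Bbound B)"
  obtain t where t0: "\<And>j. j \<notin> \<sigma> \<Longrightarrow> t $ j = 0" and t: "real_mat A *v t = real_mat A *v w"
    using spanning_solve[OF assms] by blast
  have "real_mat A *v (w - t) = 0" by (simp add: matrix_vector_mult_diff_distrib t)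
  then obtain s where s: "w - t = real_mat B *v s" using ker_real by blast
  obtain v where v: "\<And>i. \<bar>(real_mat B *v s) $ i - of_int ((B *v v) $ i)\<bar> \<le> Bbound B"
    using rounding by blast
  define N where "N = nat \<lceil>\<Sum>j\<in>UNIV. \<bar>t $ j\<bar>\<rceil>"
  have N: "t $ j \<le> real N" for j
  proof -
    have "\<bar>t $ j\<bar> \<le> (\<Sum>j\<in>UNIV. \<bar>t $ j\<bar>)"
      by (rule member_le_sum) auto
    then show ?thesis unfolding N_def by linarith
  qed
  have "\<exists>b. vecn a - vecn \<alpha> - vecn b \<in> latL A" if a: "\<forall>j\<in>\<sigma>. N \<le> a j" for a
  proof -
    have "0 \<le> int (a j) - int (\<alpha> j) + (B *v v) $ j" for j
    proof -
      have "real (\<alpha> j) + Bbound B - t $ j - of_int ((B *v v) $ j) \<le> Bbound B"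
        using v[of j] unfolding s[symmetric] by (simp add: w_def)
      moreover have "t $ j \<le> real (a j)"
      proof (cases "j \<in> \<sigma>")
        case True
        then show ?thesis using N[of j] a by (metis of_nat_le_iff order_trans)
      qed (simp add: t0)
      ultimately have "0 \<le> real_of_int (int (a j) - int (\<alpha> j) + (B *v v) $ j)" by simp
      then show ?thesis by linarith
    qed
    then have "vecn (\<lambda>j. nat (int (a j) - int (\<alpha> j) + (B *v v) $ j)) = vecn a - vecn \<alpha> + B *v v"
      by (simp add: vec_eq_iff)
    then have "vecn a - vecn \<alpha> - vecn (\<lambda>j. nat (int (a j) - int (\<alpha> j) + (B *v v) $ j)) = - (B *v v)"
      by simp
    moreover have "- (B *v v) \<in> latL A" using latB_subset_latL by (intro latL_minus) (auto simp: latB_def)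
    ultimately show ?thesis by metis
  qed
  then show ?thesis by blast
qed

text \<open>There are finitely many \<sigma>, and the sum of their thresholds works for
  each.\<close>

lemma large_imp_shifted_uniform:
  "\<exists>N. \<forall>a. spanning A {j. N \<le> a j} \<longrightarrow> (\<exists>b. vecn a - vecn \<alpha> - vecn b \<in> latL A)"
proof -
  have "\<forall>\<sigma>. \<exists>N. spanning A \<sigma> \<longrightarrow> (\<forall>a. (\<forall>j\<in>\<sigma>. N \<le> a j) \<longrightarrow> (\<exists>b. vecn a - vecn \<alpha> - vecn b \<in> latL A))"
    using large_imp_shifted by blast
  then obtain N where N: "\<And>\<sigma> a. spanning A \<sigma> \<Longrightarrow> \<forall>j\<in>\<sigma>. N \<sigma> \<le> a j \<Longrightarrow> \<exists>b. vecn a - vecn \<alpha> - vecn b \<in> latL A"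
    unfolding choice_iff by blast
  have "N \<sigma> \<le> (\<Sum>\<sigma>\<in>UNIV. N \<sigma>)" for \<sigma>
    by (rule member_le_sum) auto
  then show ?thesis
    by (intro exI[of _ "\<Sum>\<sigma>\<in>UNIV. N \<sigma>"] allI impI) (rule N, assumption, auto intro: order_trans)
qed

text \<open>A finite set meeting every coset of L_B in L, possibly in several points.\<close>

definition reps :: "(int, 'n) vec set" where
  "reps = {r \<in> latL A. \<forall>i. \<bar>r $ i\<bar> \<le> \<lfloor>Bbound B\<rfloor>}"

lemma finite_reps: "finite reps"
proof -
  have "reps \<subseteq> vec_lambda ` (UNIV \<rightarrow>\<^sub>E {- \<lfloor>Bbound B\<rfloor>..\<lfloor>Bbound B\<rfloor>})"
  proof
    fix r assume "r \<in> reps"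
    then have "vec_nth r \<in> UNIV \<rightarrow>\<^sub>E {- \<lfloor>Bbound B\<rfloor>..\<lfloor>Bbound B\<rfloor>}"
      by (auto simp: reps_def abs_le_iff minus_le_iff)
    then show "r \<in> vec_lambda ` (UNIV \<rightarrow>\<^sub>E {- \<lfloor>Bbound B\<rfloor>..\<lfloor>Bbound B\<rfloor>})"
      by (metis image_eqI vec_nth_inverse)
  qed
  then show ?thesis by (rule finite_subset) (simp add: finite_PiE)
qed

lemma exists_rep: "u \<in> latL A \<Longrightarrow> \<exists>r\<in>reps. u - r \<in> latB B"
proof -
  assume u: "u \<in> latL A"
  obtain v where v: "v \<in> latB B" "\<forall>i. \<bar>(u - v) $ i\<bar> \<le> \<lfloor>Bbound B\<rfloor>" using latL_rounding[OF u] by blast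
  then have "u - v \<in> reps" using u latB_subset_latL by (auto simp: reps_def intro: latL_diff)
  then show ?thesis using v(1) by (intro bexI[of _ "u - v"]) auto
qed

section \<open>Finiteness and orthogonality of the characters\<close>

lemma char_rep:
  assumes "\<rho> \<in> charG A B" "u \<in> latL A" "r \<in> latL A" "u - r \<in> latB B"
  shows "\<rho> u = \<rho> r"
proof -
  have "\<rho> (u - r + r) = \<rho> (u - r) * \<rho> r"
    using assms latB_subset_latL by (intro char_add) auto
  then show ?thesis using char_latB[OF assms(1,4)] by simp
qed

lemma latL_scale: "u \<in> latL A \<Longrightarrow> int k *s u \<in> latL A"
proof -
  assume "u \<in> latL A"
  moreover have "A *v (int k *s u) = int k *s (A *v u)"
    by (simp add: vec_eq_iff matrix_vector_mult_def sum_distrib_left mult_ac)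
  ultimately show ?thesis by (simp add: latL_def vec_eq_iff)
qed

lemma char_scale:
  assumes "\<rho> \<in> charG A B" "u \<in> latL A"
  shows "\<rho> (int k *s u) = \<rho> u ^ k"
proof (induction k)
  case 0
  then show ?case using char_zero[OF assms(1)] by simp
next
  case (Suc k)
  have "int (Suc k) *s u = u + int k *s u" by (simp add: vec_eq_iff algebra_simps)
  then show ?case using char_add[OF assms latL_scale[OF assms(2), of k]] Suc by simp
qed

text \<open>Two multiples of u share a representative in the finite set \<open>reps\<close>, so a
  positive multiple of u lies in L_B. The exponent does not depend on \<rho>.\<close>

lemma char_root_of_unity:
  assumes "u \<in> latL A"
  shows "\<exists>k>0. \<forall>\<rho>\<in>charG A B. \<rho> u ^ k = 1"
proof -
  obtain r where r: "\<And>k. r k \<in> reps" "\<And>k. int k *s u - r k \<in> latB B"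
    using exists_rep[OF latL_scale[OF assms]] by metis
  have "\<not> inj (r :: nat \<Rightarrow> _)"
    using finite_reps r(1) finite_subset[of "range r" reps] range_inj_infinite[of r] by blast
  then obtain i j where ij: "i < j" "r i = r j"
    by (metis injI linorder_neqE_nat)
  have "\<rho> u ^ (j - i) = 1" if \<rho>: "\<rho> \<in> charG A B" for \<rho>
  proof -
    have "int (j - i) *s u = (int j *s u - r j) - (int i *s u - r i)"
      using ij by (simp add: of_nat_diff vec_eq_iff left_diff_distrib)
    also have "\<dots> \<in> latB B" by (intro latB_diff r)
    finally show ?thesis using char_scale[OF \<rho> assms] char_latB[OF \<rho>] by metis
  qed
  then show ?thesis using ij by (intro exI[of _ "j - i"]) auto
qed

text \<open>A character is determined by its values on \<open>reps\<close>, and each of these is a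
  root of unity of an order depending only on the point.\<close>

lemma finite_charG: "finite (charG A B)"
proof -
  obtain k where k: "\<And>u. u \<in> latL A \<Longrightarrow> k u > 0 \<and> (\<forall>\<rho>\<in>charG A B. \<rho> u ^ k u = 1)"
    using char_root_of_unity by metis
  have "(\<lambda>\<rho>. restrict \<rho> reps) ` charG A B \<subseteq> (\<Pi>\<^sub>E u\<in>reps. {z. z ^ k u = 1})"
  proof (rule image_subsetI, rule PiE_I)
    show "restrict \<rho> reps u \<in> {z. z ^ k u = 1}" if "\<rho> \<in> charG A B" "u \<in> reps" for \<rho> u
      using that k[of u] by (simp add: reps_def)
  qed simp
  moreover have "finite (\<Pi>\<^sub>E u\<in>reps. {z::complex. z ^ k u = 1})"
    using k by (intro finite_PiE finite_reps finite_roots_unity) (auto simp: reps_def Suc_le_eq)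
  ultimately have "finite ((\<lambda>\<rho>. restrict \<rho> reps) ` charG A B)" by (rule finite_subset)
  moreover have "inj_on (\<lambda>\<rho>. restrict \<rho> reps) (charG A B)"
  proof (rule inj_onI, rule ext)
    fix \<rho> \<rho>' u assume \<rho>: "\<rho> \<in> charG A B" "\<rho>' \<in> charG A B" and eq: "restrict \<rho> reps = restrict \<rho>' reps"
    show "\<rho> u = \<rho>' u"
    proof (cases "u \<in> latL A")
      case True
      then obtain r where r: "r \<in> reps" "u - r \<in> latB B" using exists_rep by blast
      then have "r \<in> latL A" by (simp add: reps_def)
      then show ?thesis
        using char_rep[OF \<rho>(1) True _ r(2)] char_rep[OF \<rho>(2) True _ r(2)] r(1) fun_cong[OF eq, of r] by simp
    next
      case False
      then show ?thesis using \<rho> by (simp add: charG_def)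
    qed
  qed
  ultimately show ?thesis by (rule finite_imageD)
qed

text \<open>Writing \<open>u = B s\<close> with real \<open>s\<close>, the characters \<open>u \<mapsto> e\<^sup>2\<^sup>\<pi>\<^sup>i\<^sup>s\<^sub>l\<close> detect whether \<open>s\<close> is integral.\<close>

lemma exists_char_separating:
  assumes u: "u \<in> latL A" "u \<notin> latB B"
  shows "\<exists>\<rho>\<in>charG A B. \<rho> u \<noteq> 1"
proof -
  have ex: "\<exists>s. rvec u = real_mat B *v s" if "u \<in> latL A" for u
  proof -
    have "real_mat A *v rvec u = 0" using that by (simp add: real_mat_rvec latL_def vec_eq_iff)
    then show ?thesis using ker_real by blast
  qed
  \<comment> \<open>Real coordinates are unique because B has full column rank; hence this choice is
    additive on L and integral on L_B.\<close>
  define S where "S u = (SOME s. rvec u = real_mat B *v s)" for u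
  have S: "rvec u = real_mat B *v S u" if "u \<in> latL A" for u
    unfolding S_def using someI_ex[OF ex[OF that]] .
  define ch where "ch l u = (if u \<in> latL A then cis (2 * pi * S u $ l) else 0)" for l u
  have "ch l \<in> charG A B" for l
    unfolding charG_def
  proof (safe)
    fix u v assume uv: "u \<in> latL A" "v \<in> latL A"
    have "real_mat B *v S (u + v) = real_mat B *v (S u + S v)"
      using S[OF latL_add[OF uv]] by (simp add: rvec_add S uv matrix_vector_right_distrib)
    then have "S (u + v) = S u + S v" by (simp add: inj_real_B)
    then show "ch l (u + v) = ch l u * ch l v"
      using uv by (simp add: ch_def latL_add cis_mult distrib_left)
  next
    fix u assume uB: "u \<in> latB B"
    then have uL: "u \<in> latL A" using latB_subset_latL by blast
    obtain v where v: "u = B *v v" using uB by (auto simp: latB_def)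
    have "real_mat B *v S u = real_mat B *v rvec v"
      using S[OF uL] by (simp add: real_mat_rvec v)
    then have "S u = rvec v" by (simp add: inj_real_B)
    then show "ch l u = 1" using uL by (simp add: ch_def cis_multiple_2pi)
  qed (simp_all add: ch_def)
  moreover have "\<exists>l. ch l u \<noteq> 1"
  proof (rule ccontr)
    assume "\<nexists>l. ch l u \<noteq> 1"
    then have "\<forall>l. cis (2 * pi * S u $ l) = 1" using u(1) by (simp add: ch_def)
    then have "\<forall>l. \<exists>n::int. S u $ l = of_int n" by (simp add: cis_conv_exp exp_eq_1)
    then obtain n where n: "\<And>l. S u $ l = of_int (n l)" by metis
    then have "S u = rvec (\<chi> l. n l)" by (simp add: vec_eq_iff)
    then have "rvec u = rvec (B *v (\<chi> l. n l))" using S[OF u(1)] by (simp add: real_mat_rvec)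
    then have "u = B *v (\<chi> l. n l)" by (simp only: rvec_inj)
    then show False using u(2) by (auto simp: latB_def)
  qed
  ultimately show ?thesis by blast
qed

lemma char_mult:
  assumes "\<rho> \<in> charG A B" "\<sigma> \<in> charG A B"
  shows "(\<lambda>u. \<rho> u * \<sigma> u) \<in> charG A B"
  using assms by (simp add: charG_def)

text \<open>Choose \<rho>0 with \<rho>0(u) different from 1. Multiplication by \<rho>0 permutes the
  finite character group, so the sum equals itself times \<rho>0(u). For u outside L all summands
  vanish by convention.\<close>

lemma sum_charG_zero:
  assumes "u \<notin> latB B"
  shows "(\<Sum>\<rho>\<in>charG A B. \<rho> u) = 0"
proof (cases "u \<in> latL A")
  case False
  then show ?thesis by (intro sum.neutral) (simp add: charG_def)
next
  case True
  then obtain \<rho>0 where \<rho>0: "\<rho>0 \<in> charG A B" "\<rho>0 u \<noteq> 1" using exists_char_separating assms by blast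
  define T where "T \<rho> = (\<lambda>u. \<rho>0 u * \<rho> u)" for \<rho> :: "(int, 'n) vec \<Rightarrow> complex"
  have sub: "T ` charG A B \<subseteq> charG A B" using char_mult[OF \<rho>0(1)] by (auto simp: T_def)
  moreover have inj: "inj_on T (charG A B)"
  proof (rule inj_onI, rule ext)
    fix \<rho> \<rho>' u assume "\<rho> \<in> charG A B" "\<rho>' \<in> charG A B" and "T \<rho> = T \<rho>'"
    moreover from this(3) have "\<rho>0 u * \<rho> u = \<rho>0 u * \<rho>' u" unfolding T_def by (rule fun_cong)
    ultimately show "\<rho> u = \<rho>' u"
      using \<rho>0(1) by (cases "u \<in> latL A") (simp_all add: charG_def)
  qed
  ultimately have "T ` charG A B = charG A B" by (intro endo_inj_surj finite_charG)
  then have "(\<Sum>\<rho>\<in>charG A B. \<rho> u) = (\<Sum>\<rho>\<in>charG A B. T \<rho> u)"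
    using sum.reindex[OF inj, of "\<lambda>\<rho>. \<rho> u"] by simp
  also have "\<dots> = \<rho>0 u * (\<Sum>\<rho>\<in>charG A B. \<rho> u)" by (simp add: T_def sum_distrib_left)
  finally show ?thesis using \<rho>0(2) by simp
qed

lemma charG_nonempty: "charG A B \<noteq> {}"
proof -
  have "(\<lambda>u. if u \<in> latL A then 1 else 0) \<in> charG A B"
    using latB_subset_latL by (auto simp: charG_def latL_add)
  then show ?thesis by blast
qed

text \<open>Since \<open>\<rho>\<close> vanishes outside \<open>L\<close>, only the exponents congruent to \<open>w\<close> modulo \<open>L\<close> contribute.\<close>

lemma I_rho_functional:
  assumes \<rho>: "\<rho> \<in> charG A B" and P: "lookup P \<in> I_rho A \<rho>"
  shows "lext (\<lambda>a. \<rho> (vecn a - w)) P = 0"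
proof -
  \<comment> \<open>All w are treated together, since multiplication by \<partial>^a replaces w by w
    - a.\<close>
  have "\<forall>w. lext (\<lambda>a. \<rho> (vecn a - w)) P = 0"
  proof (rule dideal_lookup_induct[OF _ P[unfolded I_rho_def]])
    fix Q assume "lookup Q \<in> {binom u (\<rho> u) |u. u \<in> latL A}"
    then obtain u where u: "u \<in> latL A" and "lookup Q = lookup (binomP u (\<rho> u))"
      unfolding lookup_binomP by blast
    then have Q: "Q = binomP u (\<rho> u)" by (simp only: poly_mapping_eq_iff)
    show "\<forall>w. lext (\<lambda>a. \<rho> (vecn a - w)) Q = 0"
    proof
      fix w
      have e: "vecn (pos_part u) - w = u + (vecn (neg_part u) - w)"
        unfolding pos_neg_part by (rule vec_eq_iff[THEN iffD2]) simp
      have "\<rho> (vecn (pos_part u) - w) = \<rho> u * \<rho> (vecn (neg_part u) - w)"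
      proof (cases "vecn (neg_part u) - w \<in> latL A")
        case True
        then show ?thesis unfolding e by (rule char_add[OF \<rho> u])
      next
        case False
        moreover have "vecn (pos_part u) - w \<notin> latL A"
        proof
          assume "vecn (pos_part u) - w \<in> latL A"
          from latL_diff[OF this u] have "vecn (neg_part u) - w \<in> latL A"
            by (simp only: e add_diff_cancel_left')
          then show False using False by contradiction
        qed
        ultimately show ?thesis using \<rho> by (simp add: charG_def)
      qed
      then show "lext (\<lambda>a. \<rho> (vecn a - w)) Q = 0" by (simp add: Q binomP_def lext_diff lext_single)
    qed
  next
    fix Q :: "'n ppoly" and a c assume Q: "\<forall>w. lext (\<lambda>a. \<rho> (vecn a - w)) Q = 0"
    have "lext (\<lambda>b. \<rho> (vecn b - w)) (Poly_Mapping.single a c * Q) = c * lext (\<lambda>b. \<rho> (vecn b - (w - vecn a))) Q" for w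
    proof (induction Q rule: poly_mapping_add_induct)
      case (single b d)
      have "vecn (a + b) - w = vecn b - (w - vecn a)" by (simp add: vecn_add)
      then show ?case by (simp only: mult_single lext_single mult.assoc)
    qed (simp add: distrib_left lext_add)
    then show "\<forall>w. lext (\<lambda>b. \<rho> (vecn b - w)) (Poly_Mapping.single a c * Q) = 0" using Q by simp
  qed (auto simp: lext_zero lext_add finite_binom)
  then show ?thesis by blast
qed

text \<open>Summing the functionals of \<open>I_rho_functional\<close> over all characters leaves,
  by orthogonality, the exponents congruent to w modulo L_B, each weighted by the number of
  characters.\<close>

lemma class_sum_zero:
  assumes "\<And>\<rho>. \<rho> \<in> charG A B \<Longrightarrow> lookup P \<in> I_rho A \<rho>"
  shows "(\<Sum>a\<in>{a\<in>keys P. vecn a - w \<in> latB B}. lookup P a) = 0"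
proof -
  have "0 = (\<Sum>\<rho>\<in>charG A B. lext (\<lambda>a. \<rho> (vecn a - w)) P)"
    using assms I_rho_functional by simp
  also have "\<dots> = (\<Sum>a\<in>keys P. lookup P a * (\<Sum>\<rho>\<in>charG A B. \<rho> (vecn a - w)))"
    unfolding lext_def by (subst sum.swap) (simp add: sum_distrib_left)
  also have "\<dots> = (\<Sum>a\<in>keys P. if vecn a - w \<in> latB B then lookup P a * of_nat (card (charG A B)) else 0)"
    by (intro sum.cong) (auto simp: sum_charG_zero char_latB)
  also have "\<dots> = (\<Sum>a\<in>{a\<in>keys P. vecn a - w \<in> latB B}. lookup P a) * of_nat (card (charG A B))"
    by (auto simp: sum.inter_filter sum_distrib_right intro!: sum.cong)
  finally show ?thesis using finite_charG charG_nonempty by simp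
qed

end

section \<open>Operators annihilating the solutions for the lattice ideal\<close>

locale lattice_dom = open_dom U + lattice_pair A B
  for U :: "(complex, 'n::{finite,linorder}) vec set"
    and A :: "((int, 'n) vec, 'k::finite) vec" and B :: "((int, 'm::finite) vec, 'n) vec"
begin

text \<open>Monomials congruent modulo L_B act alike on f, so P f splits over congruence classes,
  each contributing a derivative times its coefficient sum, which vanishes by
  \<open>class_sum_zero\<close>.\<close>

lemma killed_by_I_charG:
  assumes f: "f \<in> HU U" and k: "\<And>u. u \<in> latB B \<Longrightarrow> opP (binomP u 1) f = (\<lambda>z. 0)"
    and P: "\<And>\<rho>. \<rho> \<in> charG A B \<Longrightarrow> lookup P \<in> I_rho A \<rho>"
  shows "opP P f = (\<lambda>z. 0)"
proof
  fix z
  \<comment> \<open>A class is encoded as its set of members in the support of P; for exponents in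
    the support, equal values of g mean congruence modulo L_B.\<close>
  define g where "g a = {b \<in> keys P. vecn b - vecn a \<in> latB B}" for a
  have "(\<Sum>a\<in>{a\<in>keys P. g a = c}. lookup P a * Dm a f z) = 0" if c: "c \<in> g ` keys P" for c
  proof -
    obtain a where a: "a \<in> keys P" "c = g a" using c by blast
    have cls: "g b = g a \<longleftrightarrow> vecn b - vecn a \<in> latB B" if "b \<in> keys P" for b
    proof
      assume "g b = g a"
      moreover have "b \<in> g b" using that latB_zero by (simp add: g_def)
      ultimately show "vecn b - vecn a \<in> latB B" by (simp add: g_def)
    next
      assume ba: "vecn b - vecn a \<in> latB B"
      have "vecn x - vecn b \<in> latB B \<longleftrightarrow> vecn x - vecn a \<in> latB B" for x
        using latB_add[OF _ ba, of "vecn x - vecn b"] latB_diff[OF _ ba, of "vecn x - vecn a"] by auto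
      then show "g b = g a" by (simp add: g_def)
    qed
    have "Dm b f z = Dm a f z" if "b \<in> keys P" "g b = g a" for b
      using binom_shift[OF f k, of "vecn b - vecn a" b a] that cls by simp
    then have "(\<Sum>b\<in>{b\<in>keys P. g b = c}. lookup P b * Dm b f z) = (\<Sum>b\<in>{b\<in>keys P. g b = c}. lookup P b) * Dm a f z"
      by (simp add: a(2) sum_distrib_right)
    moreover have "{b\<in>keys P. g b = c} = {b\<in>keys P. vecn b - vecn a \<in> latB B}" using cls a(2) by auto
    then have "(\<Sum>b\<in>{b\<in>keys P. g b = c}. lookup P b) = 0"
      using class_sum_zero[OF P, of "vecn a"] by simp
    ultimately show ?thesis by simp
  qed
  then show "opP P f z = 0"
    unfolding opP_def lext_def sum.image_gen[OF finite_keys, of _ _ g] by (intro sum.neutral) auto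
qed

end

section \<open>Generic parameters and the decomposition\<close>

text \<open>Taking real parts puts the complex hyperplane inside a real one with nonzero normal
  vector l.\<close>

lemma negligible_complex_hyperplane:
  fixes l :: "(real, 'k::finite) vec"
  assumes "l \<noteq> 0"
  shows "negligible {\<beta>. lamC l \<beta> = c}"
proof -
  define a :: "(complex, 'k) vec" where "a = (\<chi> k. of_real (l $ k))"
  have "a \<noteq> 0" using assms by (auto simp: a_def vec_eq_iff)
  moreover have "a \<bullet> \<beta> = Re (lamC l \<beta>)" for \<beta>
    by (simp add: a_def inner_vec_def inner_complex_def lamC_def)
  then have "{\<beta>. lamC l \<beta> = c} \<subseteq> {\<beta>. a \<bullet> \<beta> = Re c}" by auto
  ultimately show ?thesis using negligible_subset negligible_hyperplane by blast
qed

text \<open>One form is fixed for each of the finitely many non-spanning \<sigma>; the parameters to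
  avoid then fill one hyperplane for each \<sigma> and each of the countably many w.\<close>

lemma generic_parameters:
  fixes A :: "((int, 'n::finite) vec, 'k::finite) vec"
  shows "\<exists>E. negligible E \<and> (\<forall>\<beta>. \<beta> \<notin> E \<longrightarrow> (\<forall>\<sigma>. \<not> spanning A \<sigma> \<longrightarrow>
    (\<exists>l. (\<forall>j\<in>\<sigma>. lamA A l j = 0) \<and> (\<forall>w. lamC l (\<beta> - cdeg A w) \<noteq> 0))))"
proof -
  have "\<forall>\<sigma>. \<exists>l. \<not> spanning A \<sigma> \<longrightarrow> (\<forall>j\<in>\<sigma>. lamA A l j = 0) \<and> l \<noteq> 0"
    unfolding spanning_def by blast
  then obtain l where l: "\<And>\<sigma>. \<not> spanning A \<sigma> \<Longrightarrow> (\<forall>j\<in>\<sigma>. lamA A (l \<sigma>) j = 0) \<and> l \<sigma> \<noteq> 0"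
    unfolding choice_iff by blast
  define E where "E = (\<Union>(\<sigma>, w)\<in>{\<sigma>. \<not> spanning A \<sigma>} \<times> UNIV. {\<beta>. lamC (l \<sigma>) \<beta> = lamC (l \<sigma>) (cdeg A w)})"
  have "finite {\<sigma>. \<not> spanning A \<sigma>}" by (rule finite_subset[of _ "Pow UNIV"]) auto
  then have "negligible E"
    unfolding E_def using l
    by (intro negligible_countable_Union) (auto intro!: negligible_complex_hyperplane intro: countable_finite)
  moreover have "\<exists>l. (\<forall>j\<in>\<sigma>. lamA A l j = 0) \<and> (\<forall>w. lamC l (\<beta> - cdeg A w) \<noteq> 0)"
    if "\<beta> \<notin> E" "\<not> spanning A \<sigma>" for \<beta> \<sigma>
    using that l[OF that(2)] by (intro exI[of _ "l \<sigma>"]) (auto simp: E_def lamC_diff)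
  ultimately show ?thesis by blast
qed

section \<open>Assembling the decomposition\<close>

context lattice_dom
begin

definition ext0 :: "((complex, 'n) vec \<Rightarrow> complex) \<Rightarrow> (complex, 'n) vec \<Rightarrow> complex" where
  "ext0 f = (\<lambda>z. if z \<in> U then f z else 0)"

lemma ext0_solution:
  assumes "is_solution A \<beta> P U f"
  shows "ext0 f \<in> HU U" "Eul A \<beta> (ext0 f)" "\<And>Q. lookup Q \<in> P \<Longrightarrow> opP Q (ext0 f) = (\<lambda>z. 0)"
proof -
  show H: "ext0 f \<in> HU U"
    using assms holo_on_cong[OF open_U, of "ext0 f" f] by (simp add: is_solution_def HU_def ext0_def)
  show "Eul A \<beta> (ext0 f)"
    unfolding Eul_def
  proof (intro allI)
    fix k z
    show "(\<Sum>i\<in>UNIV. of_int (A $ k $ i) * (z $ i * dd U i (ext0 f) z)) = \<beta> $ k * ext0 f z"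
    proof (cases "z \<in> U")
      case True
      have "dd U i (ext0 f) z = pd i f z" for i
        using pd_cong_open[OF open_U True, of "ext0 f" f i] True by (simp add: dd_def ext0_def)
      then show ?thesis using assms True by (simp add: is_solution_def ext0_def mult.assoc)
    qed (simp add: dd_off ext0_def)
  qed
  show "opP Q (ext0 f) = (\<lambda>z. 0)" if "lookup Q \<in> P" for Q
  proof
    fix z
    show "opP Q (ext0 f) z = 0"
    proof (cases "z \<in> U")
      case True
      have "dapply (lookup Q) f z = opP Q (ext0 f) z"
        by (rule dapply_eq_opP[OF H True]) (simp add: ext0_def)
      then show ?thesis using assms True that by (simp add: is_solution_def)
    next
      case False
      then show ?thesis by (rule HU_off[OF HU_opP[OF H]])
    qed
  qed
qed

lemma is_solution_I_rho:
  assumes g: "g \<in> HU U" "Eul A \<beta> g"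
    and k: "\<And>u. u \<in> latL A \<Longrightarrow> opP (binomP u (\<rho> u)) g = (\<lambda>z. 0)"
  shows "is_solution A \<beta> (I_rho A \<rho>) U g"
  unfolding is_solution_def
proof (intro conjI ballI allI)
  show "holo_on U g" using g(1) by (simp add: HU_def)
next
  fix p z assume p: "p \<in> I_rho A \<rho>" and z: "z \<in> U"
  define S where "S = {binom u (\<rho> u) |u. u \<in> latL A}"
  have S: "finite {a. q a \<noteq> 0}" if "q \<in> S" for q using that finite_binom by (auto simp: S_def)
  then have "finite {a. p a \<noteq> 0}" using finite_dideal[of S p] p by (simp add: I_rho_def S_def)
  \<comment> \<open>The ideal inherits finite support from the binomials, so p is the coefficient
    function of a polynomial.\<close>
  then have P: "lookup (Abs_poly_mapping p) = p" by simp
  have "opP (Abs_poly_mapping p) g = (\<lambda>z. 0)"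
  proof (rule dideal_kills[OF g(1) S])
    fix Q assume "lookup Q \<in> S"
    then obtain u where "u \<in> latL A" "lookup Q = lookup (binomP u (\<rho> u))"
      unfolding lookup_binomP S_def by blast
    then show "opP Q g = (\<lambda>z. 0)" using k by (simp only: poly_mapping_eq_iff[symmetric])
  next
    show "lookup (Abs_poly_mapping p) \<in> dideal S" using p by (simp only: P I_rho_def S_def)
  qed
  then show "dapply p g z = 0"
    using dapply_eq_opP[OF g(1) z, of g "Abs_poly_mapping p"] by (simp only: P)
next
  fix k z assume z: "z \<in> U"
  then show "(\<Sum>j\<in>UNIV. of_int (A $ k $ j) * z $ j * pd j g z) = \<beta> $ k * g z"
    using g(2)[unfolded Eul_def, rule_format, of k z] by (simp add: dd_def mult.assoc)
qed

text \<open>The starting family is extended until its index set contains 0; the members at 0 are the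
  components.\<close>

lemma decompose:
  assumes gen: "\<And>\<sigma>. \<not> spanning A \<sigma> \<Longrightarrow> \<exists>l. (\<forall>j\<in>\<sigma>. lamA A l j = 0) \<and> (\<forall>w. lamC l (\<beta> - cdeg A w) \<noteq> 0)"
    and J: "J \<subseteq> charG A B" and f: "f \<in> HU U" "Eul A \<beta> f"
    and kill: "\<And>P. (\<And>\<rho>. \<rho> \<in> J \<Longrightarrow> lookup P \<in> I_rho A \<rho>) \<Longrightarrow> opP P f = (\<lambda>z. 0)"
  shows "\<exists>g. (\<forall>\<rho>\<in>J. is_solution A \<beta> (I_rho A \<rho>) U (g \<rho>)) \<and> (\<forall>z. f z = (\<Sum>\<rho>\<in>J. g \<rho> z))"
proof -
  have finJ: "finite J" using J finite_charG by (rule finite_subset)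
  have "\<exists>\<alpha> \<Phi>. solution_family A \<beta> J f {w. \<exists>a. w - vecn \<alpha> - vecn a \<in> latL A} \<Phi>"
    by (rule solution_family_base[OF finJ J f kill])
  then obtain \<alpha> \<Phi> where \<Phi>: "solution_family A \<beta> J f {w. \<exists>a. w - vecn \<alpha> - vecn a \<in> latL A} \<Phi>"
    by (elim exE)
  obtain N where N: "\<And>a. spanning A {j. N \<le> a j} \<Longrightarrow> \<exists>b. vecn a - vecn \<alpha> - vecn b \<in> latL A"
    using large_imp_shifted_uniform by blast
  have "\<exists>V \<Psi>. solution_family A \<beta> J f V \<Psi> \<and> 0 \<in> V"
    by (rule solution_family_reaches_zero[OF \<Phi> f gen _ spanning_UNIV]) (use N in blast)+
  then obtain V \<Psi> where S: "solution_family A \<beta> J f V \<Psi>" and V0: "0 \<in> V" by (elim exE conjE)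
  have up: "w + axis j 1 \<in> V" if "w \<in> V" for w j
    using S that by (auto simp: solution_family_def)
  have \<Psi>: "\<Psi> \<rho> w \<in> HU U" "Eul A (\<beta> - cdeg A w) (\<Psi> \<rho> w)" "dd U j (\<Psi> \<rho> w) = \<Psi> \<rho> (w + axis j 1)"
    "u \<in> latL A \<Longrightarrow> \<Psi> \<rho> (w + u) = (\<lambda>z. \<rho> u * \<Psi> \<rho> w z)" if "\<rho> \<in> J" "w \<in> V" for \<rho> w j u
    using S that unfolding solution_family_def by blast+
  have "is_solution A \<beta> (I_rho A \<rho>) U (\<Psi> \<rho> 0)" if \<rho>: "\<rho> \<in> J" for \<rho>
  proof (rule is_solution_I_rho)
    \<comment> \<open>Derivatives of the member at 0 are the members at nonnegative indices, so the
      shift rule from u_- to u_+ becomes the binomial equation.\<close>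
    have D: "vecn a \<in> V \<and> Dm a (\<Psi> \<rho> 0) = \<Psi> \<rho> (vecn a)" for a
    proof (induction a rule: multi_index_induct)
      case zero
      show ?case unfolding vecn_zero Dm_zero using V0 by simp
    next
      case (step a j)
      then show ?case
        using up \<Psi>(3)[OF \<rho>] \<Psi>(1)[OF \<rho> V0] by (simp only: vecn_add vecn_unit Dm_step)
    qed
    show "\<Psi> \<rho> 0 \<in> HU U" by (rule \<Psi>(1)[OF \<rho> V0])
    show "Eul A \<beta> (\<Psi> \<rho> 0)" using \<Psi>(2)[OF \<rho> V0] by simp
    fix u assume "u \<in> latL A"
    then have "\<Psi> \<rho> (vecn (neg_part u) + u) = (\<lambda>z. \<rho> u * \<Psi> \<rho> (vecn (neg_part u)) z)"
      using \<Psi>(4)[OF \<rho>] D by blast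
    then show "opP (binomP u (\<rho> u)) (\<Psi> \<rho> 0) = (\<lambda>z. 0)"
      using D by (intro binom_shift_conv) (simp only: pos_neg_part)
  qed
  moreover have "f z = (\<Sum>\<rho>\<in>J. \<Psi> \<rho> 0 z)" for z
  proof -
    have "vecn 0 \<in> V" using V0 by (simp only: vecn_zero)
    then have "(\<Sum>\<rho>\<in>J. \<Psi> \<rho> (vecn 0) z) = Dm 0 f z" using S unfolding solution_family_def by blast
    then show ?thesis by (simp only: vecn_zero Dm_zero)
  qed
  ultimately show ?thesis by (intro exI[of _ "\<lambda>\<rho>. \<Psi> \<rho> 0"]) blast
qed

lemma decompose_solution:
  assumes gen: "\<And>\<sigma>. \<not> spanning A \<sigma> \<Longrightarrow> \<exists>l. (\<forall>j\<in>\<sigma>. lamA A l j = 0) \<and> (\<forall>w. lamC l (\<beta> - cdeg A w) \<noteq> 0)"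
    and J: "J \<subseteq> charG A B" and f: "is_solution A \<beta> P U f"
    and kill: "\<And>Q. (\<And>\<rho>. \<rho> \<in> J \<Longrightarrow> lookup Q \<in> I_rho A \<rho>) \<Longrightarrow> opP Q (ext0 f) = (\<lambda>z. 0)"
  shows "\<exists>g. (\<forall>\<rho>\<in>J. is_solution A \<beta> (I_rho A \<rho>) U (g \<rho>)) \<and> (\<forall>z\<in>U. f z = (\<Sum>\<rho>\<in>J. g \<rho> z))"
proof -
  obtain g where "\<forall>\<rho>\<in>J. is_solution A \<beta> (I_rho A \<rho>) U (g \<rho>)" "\<forall>z. ext0 f z = (\<Sum>\<rho>\<in>J. g \<rho> z)"
    using decompose[OF gen J ext0_solution(1,2)[OF f] kill] by blast
  moreover have "f z = ext0 f z" if "z \<in> U" for z using that by (simp add: ext0_def)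
  ultimately show ?thesis by (intro exI[of _ g]) simp
qed

end

theorem theorem7p4:
  fixes A :: "((int, 'n::{finite,linorder}) vec, 'k::finite) vec"
    and B :: "((int, 'm::finite) vec, 'n) vec"
    and k0 :: 'k
  assumes "CARD('m) < CARD('n)"
    and "CARD('k) = CARD('n) - CARD('m)"
    and "rank (real_mat B) = CARD('m)"
    and "rank (real_mat A) = CARD('k)"
    and "\<forall>l. (\<Sum>i\<in>UNIV. B $ i $ l) = 0"
    and "\<forall>j. A $ k0 $ j = 1"
    and "A ** B = 0"
  shows "\<exists>E :: (complex^'k) set. negligible E \<and>
    (\<forall>\<beta>. \<beta> \<notin> E \<longrightarrow>
       (\<forall>J U f. J \<subseteq> charG A B \<and> J \<noteq> {} \<and> open U
          \<and> is_solution A \<beta> (I_J A J) U f \<longrightarrow>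
          (\<exists>g. (\<forall>\<rho>\<in>J. is_solution A \<beta> (I_rho A \<rho>) U (g \<rho>))
               \<and> (\<forall>z\<in>U. f z = (\<Sum>\<rho>\<in>J. g \<rho> z))))
     \<and> (\<forall>U f. open U \<and> is_solution A \<beta> (I_B B) U f \<longrightarrow>
          (\<exists>g. (\<forall>\<rho>\<in>charG A B. is_solution A \<beta> (I_rho A \<rho>) U (g \<rho>))
               \<and> (\<forall>z\<in>U. f z = (\<Sum>\<rho>\<in>charG A B. g \<rho> z)))))"
proof -
  \<comment> \<open>The exceptional set depends on A only and serves all J, U and f at once.\<close>
  obtain E where E: "negligible E" and gen: "\<And>\<beta> \<sigma>. \<beta> \<notin> E \<Longrightarrow> \<not> spanning A \<sigma> \<Longrightarrow>
      \<exists>l. (\<forall>j\<in>\<sigma>. lamA A l j = 0) \<and> (\<forall>w. lamC l (\<beta> - cdeg A w) \<noteq> 0)"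
    using generic_parameters[of A] by blast
  show ?thesis
  proof (intro exI[of _ E] conjI E allI impI; elim conjE)
    fix \<beta> J U f
    assume \<beta>: "\<beta> \<notin> E" and J: "J \<subseteq> charG A B" and U: "open U" and f: "is_solution A \<beta> (I_J A J) U f"
    interpret lattice_dom U A B by unfold_locales (use assms U in auto)
    show "\<exists>g. (\<forall>\<rho>\<in>J. is_solution A \<beta> (I_rho A \<rho>) U (g \<rho>)) \<and> (\<forall>z\<in>U. f z = (\<Sum>\<rho>\<in>J. g \<rho> z))"
    proof (rule decompose_solution[OF gen[OF \<beta>] J f])
      fix Q assume "\<And>\<rho>. \<rho> \<in> J \<Longrightarrow> lookup Q \<in> I_rho A \<rho>"
      then show "opP Q (ext0 f) = (\<lambda>z. 0)" by (intro ext0_solution(3)[OF f]) (simp add: I_J_def)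
    qed
  next
    fix \<beta> U f
    assume \<beta>: "\<beta> \<notin> E" and U: "open U" and f: "is_solution A \<beta> (I_B B) U f"
    interpret lattice_dom U A B by unfold_locales (use assms U in auto)
    show "\<exists>g. (\<forall>\<rho>\<in>charG A B. is_solution A \<beta> (I_rho A \<rho>) U (g \<rho>)) \<and> (\<forall>z\<in>U. f z = (\<Sum>\<rho>\<in>charG A B. g \<rho> z))"
    \<comment> \<open>Here J is the whole character group; the annihilation condition comes from the
      binomials of L_B through \<open>killed_by_I_charG\<close>.\<close>
    proof (rule decompose_solution[OF gen[OF \<beta>] subset_refl f])
      fix Q assume Q: "\<And>\<rho>. \<rho> \<in> charG A B \<Longrightarrow> lookup Q \<in> I_rho A \<rho>"
      have "opP (binomP u 1) (ext0 f) = (\<lambda>z. 0)" if "u \<in> latB B" for u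
        using that by (intro ext0_solution(3)[OF f]) (auto simp: I_B_def lookup_binomP intro: dideal.gen)
      then show "opP Q (ext0 f) = (\<lambda>z. 0)"
        using killed_by_I_charG[OF ext0_solution(1)[OF f]] Q by blast
    qed
  qed
qed

end
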